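(* Let $\lambda$ be a partition of $N$ of length $p$. Choose uniformly at random a set partition $\pi$ of $\{1,\ldots,N\}$ of type $\lambda$, and then, uniformly at random, a permutation $\beta \in S_\pi$. Then the probability that $(1\ 2\ \ldots\ N)\beta^{-1}$ is an $N$-cycle is exactly $1/(N-p+1)$.
   Context: A set partition of $\{1,\ldots,N\}$ has type $\lambda$ if its block sizes, sorted, form the partition $\lambda$. For a set partition $\pi$, $S_\pi$ denotes the set of permutations $\beta$ of $\{1,\ldots,N\}$ each of whose cycles is contained in a single block of $\pi$. *)

theory Defs
  imports Complex_Main "HOL-Library.Multiset" "HOL-Library.Disjoint_Sets" "HOL-Combinatorics.Combinatorics"
begin

definition long_cycle :: "nat \<Rightarrow> nat \<Rightarrow> nat" where
  "long_cycle N x = (if 1 \<le> x \<and> x < N then x + 1 else if x = N then 1 else x)"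

definition set_partitions_of_type :: "nat \<Rightarrow> nat multiset \<Rightarrow> nat set set set" where
  "set_partitions_of_type N lam =
     {P. partition_on {1..N} P \<and> image_mset card (mset_set P) = lam}"

definition S_part :: "nat \<Rightarrow> nat set set \<Rightarrow> (nat \<Rightarrow> nat) set" where
  "S_part N P = {\<beta>. \<beta> permutes {1..N} \<and> (\<forall>x\<in>{1..N}. \<exists>B\<in>P. orbit \<beta> x \<subseteq> B)}"

definition is_N_cycle :: "nat \<Rightarrow> (nat \<Rightarrow> nat) \<Rightarrow> bool" where
  "is_N_cycle N \<sigma> \<longleftrightarrow> \<sigma> permutes {1..N} \<and> cyclic_on \<sigma> {1..N}"

end

(*
  Two facts drive the proof. First, for arbitrary maps f off V and w on V, the number of permutations
  beta of V such that the map equal to w o beta on V and to f elsewhere sends every point into a target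
  set T is (|V| - 1)! times the number of y in V whose image w y reaches T before returning to V: this is
  the degree-sequence form of Cayley's formula. Second, c o beta is a full cycle iff, after redirecting the
  value of c at one point r to a point outside, every point leaves {1..N} under c o beta.
  Applying the first fact block by block replaces beta by the choice s of one point in each block, with
  r chosen in its own block R (as in the BEST theorem). For fixed s the condition depends on c only through
  its values on p - 1 points; applying the first fact to permutations of the complement of these points
  shows that exactly one in N - p + 1 of the permutations c satisfying it are N-cycles, and applying it to c
  itself counts these permutations as (N - 1)! |R|. This averages over all N-cycles c for fixed pi;
  conjugation transfers the average to fixed c and random pi.
*)
theory Submission
  imports Defs
begin

section \<open>Paths of a map into a target set\<close>

text \<open>No step may start in \<open>V\<close>, so \<open>V\<close> collects the points whose
  value is still undecided, and a path may end in \<open>V\<close> only at a point of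
  \<open>T\<close>. For \<open>V = {}\<close> this is plain reachability of
  \<open>T\<close>.\<close>

inductive reaches :: "('a \<Rightarrow> 'a) \<Rightarrow> 'a set \<Rightarrow> 'a set \<Rightarrow> 'a \<Rightarrow> bool"
  for f :: "'a \<Rightarrow> 'a" and V T :: "'a set" where
  target: "x \<in> T \<Longrightarrow> reaches f V T x"
| step: "x \<notin> V \<Longrightarrow> reaches f V T (f x) \<Longrightarrow> reaches f V T x"

text \<open>When the complement of \<open>T\<close> is finite, this means that the functional graph
  of \<open>f\<close> has no cycle disjoint from \<open>T\<close>: cut at \<open>T\<close>, it is a
  forest directed towards \<open>T\<close>.\<close>

definition absorbing :: "('a \<Rightarrow> 'a) \<Rightarrow> 'a set \<Rightarrow> bool" where
  "absorbing f T \<longleftrightarrow> (\<forall>x. reaches f {} T x)"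

lemma reaches_step_iff: "x \<notin> V \<Longrightarrow> x \<notin> T \<Longrightarrow> reaches f V T x \<longleftrightarrow> reaches f V T (f x)"
  by (meson reaches.cases reaches.step)

lemma reaches_avoided_iff: "x \<in> V \<Longrightarrow> reaches f V T x \<longleftrightarrow> x \<in> T"
  by (meson reaches.cases reaches.target)

lemma reaches_mono:
  assumes "reaches f V T x" "V' \<subseteq> V" "T \<subseteq> T'"
    and "\<And>x. x \<notin> V \<Longrightarrow> x \<notin> T \<Longrightarrow> g x = f x"
  shows "reaches g V' T' x"
  using assms(1)
proof induction
  case (target x)
  then show ?case using assms(3) by (auto intro: reaches.target)
next
  case (step x)
  show ?case
  proof (cases "x \<in> T")
    case True
    then show ?thesis using assms(3) by (auto intro: reaches.target)
  next
    case False
    then show ?thesis using step assms(2,4) by (metis reaches.step subsetD)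
  qed
qed

lemma reaches_upd:
  assumes "reaches f V T x" "b \<in> V"
  shows "reaches (f(b := a)) (V - {b}) T x"
  using assms by (intro reaches_mono[OF assms(1)]) auto

text \<open>A path that used to stop at \<open>b\<close> goes on to \<open>a\<close>, whose own path
  to \<open>T\<close> takes no step from \<open>b\<close>. This carries the reachability hypothesis
  of the later induction over to \<open>V - {b}\<close>.\<close>

lemma reaches_upd_target:
  assumes "reaches f {} (T \<union> V) x" "b \<in> V" "reaches f V T a"
  shows "reaches (f(b := a)) {} (T \<union> (V - {b})) x"
proof -
  define g where "g = f(b := a)"
  have a: "reaches g {} (T \<union> (V - {b})) a"
    using reaches_upd[OF assms(3,2), of a] by (rule reaches_mono) (auto simp: g_def)
  have b: "reaches g {} (T \<union> (V - {b})) b"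
    by (rule reaches.step) (use a in \<open>simp_all add: g_def\<close>)
  have "reaches g {} (T \<union> (V - {b})) x"
    using assms(1)
  proof induction
    case (target x)
    then show ?case using b by (cases "x = b") (auto intro: reaches.target)
  next
    case (step x)
    moreover have "g x = f x" if "x \<noteq> b" using that by (simp add: g_def)
    ultimately show ?case
      using b reaches.step[of x "{}" g "T \<union> (V - {b})"] by (cases "x = b") auto
  qed
  then show ?thesis by (simp only: g_def)
qed

text \<open>The path from \<open>x\<close> first meets \<open>V\<close> at a single point and is
  stuck there. Redefining the map at \<open>b\<close> helps only if \<open>b\<close> is that point,
  and then the path continues through \<open>a\<close> to \<open>T\<close>.\<close>

lemma card_reaches_upd:
  assumes "reaches f {} (T \<union> V) x" "\<not> reaches f V T x" "reaches f V T a" "V \<inter> T = {}"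
  shows "card {b \<in> V. reaches (f(b := a)) (V - {b}) T x} = 1"
proof -
  have in_V: "card {b \<in> V. reaches (f(b := a)) (V - {b}) T x} = 1" if x: "x \<in> V" for x
  proof -
    have "reaches (f(b := a)) (V - {b}) T x \<longleftrightarrow> b = x" if "b \<in> V" for b
    proof (cases "b = x")
      case True
      have "reaches (f(x := a)) (V - {x}) T x"
        by (rule reaches.step) (use reaches_upd[OF assms(3) x, of a] in simp_all)
      then show ?thesis using True by blast
    next
      case False
      then show ?thesis using x assms(4) reaches_avoided_iff[of x "V - {b}"] by blast
    qed
    then have "{b \<in> V. reaches (f(b := a)) (V - {b}) T x} = {x}" using x by blast
    then show ?thesis by (metis card_1_singleton_iff One_nat_def)
  qed
  show ?thesis
    using assms(1,2)
  proof induction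
    case (target x)
    then show ?case using in_V by (blast intro: reaches.target)
  next
    case (step x)
    show ?case
    proof (cases "x \<in> V")
      case False
      then have nT: "x \<notin> T" and nf: "\<not> reaches f V T (f x)"
        using step(4) by (auto intro: reaches.intros)
      have "reaches (f(b := a)) (V - {b}) T x \<longleftrightarrow> reaches (f(b := a)) (V - {b}) T (f x)"
        if "b \<in> V" for b
      proof -
        have "(f(b := a)) x = f x" using that False by auto
        then show ?thesis using reaches_step_iff[of x "V - {b}" T "f(b := a)"] nT False by auto
      qed
      then have "{b \<in> V. reaches (f(b := a)) (V - {b}) T x}
          = {b \<in> V. reaches (f(b := a)) (V - {b}) T (f x)}" by blast
      then show ?thesis using step.IH[OF nf] by argo
    qed (rule in_V)
  qed
qed

text \<open>Cut the path after its last step from a point of \<open>V\<close>; from there on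
  \<open>g\<close> agrees with \<open>f\<close>.\<close>

lemma reaches_override:
  assumes "reaches g {} T x" "\<And>x. x \<notin> V \<Longrightarrow> g x = f x"
  shows "reaches f V T x \<or> (\<exists>v\<in>V. reaches f V T (g v))"
  using assms(1)
proof induction
  case (target x)
  then show ?case by (auto intro: reaches.target)
next
  case (step x)
  then show ?case using assms(2)[of x] by (cases "x \<in> V") (auto intro: reaches.step)
qed

section \<open>Counting the permutations that produce a forest\<close>

text \<open>With the value at \<open>b\<close> fixed, a bijection from \<open>V - {b}\<close> to
  \<open>V - {y}\<close> remains. The transposition identifies \<open>V - {y}\<close> with
  \<open>V - {b}\<close>, so that an induction on \<open>V\<close> stays within permutations of a
  set.\<close>

lemma permutes_image_swap_bij:
  assumes "b \<in> V" "y \<in> V"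
  shows "bij_betw (\<lambda>\<beta>. transpose b y \<circ> \<beta>) {\<beta>. \<beta> permutes V \<and> \<beta> b = y} {\<beta>. \<beta> permutes (V - {b})}"
proof (rule bij_betw_byWitness[where f' = "\<lambda>\<beta>. transpose b y \<circ> \<beta>"])
  show "\<forall>\<beta>\<in>{\<beta>. \<beta> permutes V \<and> \<beta> b = y}. transpose b y \<circ> (transpose b y \<circ> \<beta>) = \<beta>"
    by (auto simp: fun_eq_iff)
  show "\<forall>\<beta>\<in>{\<beta>. \<beta> permutes (V - {b})}. transpose b y \<circ> (transpose b y \<circ> \<beta>) = \<beta>"
    by (auto simp: fun_eq_iff)
  show "(\<lambda>\<beta>. transpose b y \<circ> \<beta>) ` {\<beta>. \<beta> permutes V \<and> \<beta> b = y} \<subseteq> {\<beta>. \<beta> permutes (V - {b})}"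
  proof (clarsimp)
    fix \<beta> assume "\<beta> permutes V" "y = \<beta> b"
    then have p: "transpose b (\<beta> b) \<circ> \<beta> permutes V"
      using assms by (intro permutes_compose permutes_swap_id) auto
    show "transpose b (\<beta> b) \<circ> \<beta> permutes (V - {b})"
      by (rule permutes_superset[OF p]) auto
  qed
  show "(\<lambda>\<beta>. transpose b y \<circ> \<beta>) ` {\<beta>. \<beta> permutes (V - {b})} \<subseteq> {\<beta>. \<beta> permutes V \<and> \<beta> b = y}"
  proof clarsimp
    fix \<beta> assume \<beta>: "\<beta> permutes (V - {b})"
    then have "\<beta> b = b" by (auto simp: permutes_def)
    moreover have "transpose b y \<circ> \<beta> permutes V"
      using assms permutes_subset[OF \<beta>, of V] by (intro permutes_compose permutes_swap_id) auto
    ultimately show "transpose b y \<circ> \<beta> permutes V \<and> transpose b y (\<beta> b) = y" by simp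
  qed
qed

lemma sum_card_filter_swap:
  assumes "finite A" "finite B"
  shows "(\<Sum>a\<in>A. card {b\<in>B. Q a b}) = (\<Sum>b\<in>B. card {a\<in>A. Q a b})"
  using sum.swap[of "\<lambda>a b. if Q a b then 1 else (0::nat)" B A] assms
  by (simp add: sum.inter_filter[symmetric])

text \<open>Up to its first visit to \<open>V\<close>, a path of the overridden map is a path of
  \<open>f\<close>.\<close>

lemma absorbing_override_imp_reaches:
  assumes "absorbing (override_on f h V) T"
  shows "reaches f {} (T \<union> V) x"
proof -
  have "reaches (override_on f h V) {} T x" using assms by (simp add: absorbing_def)
  then show ?thesis
  proof induction
    case (step x)
    then show ?case by (cases "x \<in> V") (auto simp: override_on_def intro: reaches.intros)
  qed (auto intro: reaches.target)
qed

text \<open>The fibres of \<open>w\<close> prescribe how many arcs from \<open>V\<close> enter each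
  point, and \<open>\<beta>\<close> distributes these arcs. Induction on the size of
  \<open>V\<close>: fix \<open>y0\<close> such that \<open>w y0\<close> already leads to
  \<open>T\<close>, sort the \<open>\<beta>\<close> by the point \<open>b\<close> with
  \<open>\<beta> b = y0\<close>, and make the arc from \<open>b\<close> to \<open>w y0\<close> part
  of \<open>f\<close>.\<close>

theorem card_absorbing_permutations:
  fixes f w :: "'a \<Rightarrow> 'a"
  assumes "finite V" "V \<inter> T = {}" "\<And>x. reaches f {} (T \<union> V) x"
  shows "card {\<beta>. \<beta> permutes V \<and> absorbing (override_on f (w \<circ> \<beta>) V) T} =
         (if V = {} then 1 else fact (card V - 1) * card {y\<in>V. reaches f V T (w y)})"
  using assms
proof (induction "card V" arbitrary: V f w)
  case 0
  then have "V = {}" by simp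
  moreover have "{\<beta>. \<beta> permutes {} \<and> absorbing (override_on f (w \<circ> \<beta>) {}) T} = {id}"
    using 0 by (auto simp: absorbing_def override_on_def \<open>V = {}\<close>)
  ultimately show ?case by simp
next
  case (Suc n)
  then have fin: "finite V" and ne: "V \<noteq> {}" and cV: "card V = Suc n" by auto
  show ?case
  proof (cases "\<exists>y0\<in>V. reaches f V T (w y0)")
    case False
    \<comment> \<open>On a path from a point of \<open>V\<close> to \<open>T\<close>, the last step
      from \<open>V\<close> would lead to a \<open>w y\<close> of the kind excluded in this
      case.\<close>
    have "\<not> absorbing (override_on f (w \<circ> \<beta>) V) T" if \<beta>: "\<beta> permutes V" for \<beta>
    proof
      assume G: "absorbing (override_on f (w \<circ> \<beta>) V) T"
      obtain v where v: "v \<in> V" using ne by blast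
      have "\<not> reaches f V T v" using v Suc.prems(2) by (auto simp: reaches_avoided_iff)
      then have "\<exists>v\<in>V. reaches f V T (override_on f (w \<circ> \<beta>) V v)"
        using G reaches_override[of "override_on f (w \<circ> \<beta>) V" T v V f]
        by (auto simp: absorbing_def override_on_def)
      then obtain u where "u \<in> V" "reaches f V T (w (\<beta> u))" by (auto simp: override_on_def)
      then show False using False permutes_in_image[OF \<beta>] by blast
    qed
    then have 1: "{\<beta>. \<beta> permutes V \<and> absorbing (override_on f (w \<circ> \<beta>) V) T} = {}" by auto
    have 2: "{y\<in>V. reaches f V T (w y)} = {}" using False by auto
    show ?thesis unfolding 1 2 using ne by simp
  next
    case True
    then obtain y0 where y0: "y0 \<in> V" "reaches f V T (w y0)" by blast
    define X where "X b = {\<beta>. \<beta> permutes V \<and> \<beta> b = y0 \<and> absorbing (override_on f (w \<circ> \<beta>) V) T}" for b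
    define f' where "f' b = f(b := w y0)" for b
    define k where "k = card {y\<in>V. reaches f V T (w y)}"
    have XU: "{\<beta>. \<beta> permutes V \<and> absorbing (override_on f (w \<circ> \<beta>) V) T} = (\<Union>b\<in>V. X b)"
    proof (intro equalityI subsetI)
      fix \<beta> assume b: "\<beta> \<in> {\<beta>. \<beta> permutes V \<and> absorbing (override_on f (w \<circ> \<beta>) V) T}"
      then have p: "\<beta> permutes V" by simp
      have "inv \<beta> y0 \<in> V" "\<beta> (inv \<beta> y0) = y0"
        using p y0(1) permutes_in_image[OF permutes_inv[OF p]] permutes_inverses[OF p] by auto
      then show "\<beta> \<in> (\<Union>b\<in>V. X b)" using b by (auto simp: X_def)
    qed (auto simp: X_def)
    have finX: "finite (X b)" for b
      by (rule finite_subset[OF _ finite_permutations[OF fin]]) (auto simp: X_def)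
    have "X b \<inter> X b' = {}" if "b \<noteq> b'" for b b'
    proof -
      have "\<not> (\<beta> permutes V \<and> \<beta> b = y0 \<and> \<beta> b' = y0)" for \<beta>
        using that permutes_inj[of \<beta> V] by (metis injD)
      then show ?thesis by (auto simp: X_def)
    qed
    then have cU: "card (\<Union>b\<in>V. X b) = (\<Sum>b\<in>V. card (X b))"
      using fin finX by (intro card_UN_disjoint) auto
    have cX: "card (X b) = (if n = 0 then 1 else
        fact (n - 1) * card {y\<in>V - {y0}. reaches (f' b) (V - {b}) T (w y)})" if b: "b \<in> V" for b
    proof -
      let ?Z = "{\<beta>. \<beta> permutes (V - {b}) \<and>
        absorbing (override_on (f' b) ((w \<circ> transpose b y0) \<circ> \<beta>) (V - {b})) T}"
      \<comment> \<open>\<open>w \<circ> transpose b y0\<close> undoes the renaming of values caused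
        by composing \<open>\<beta>\<close> with the transposition.\<close>
      have eq: "override_on (f' b) ((w \<circ> transpose b y0) \<circ> (transpose b y0 \<circ> \<beta>)) (V - {b})
          = override_on f (w \<circ> \<beta>) V" if "\<beta> b = y0" for \<beta>
        using that b by (auto simp: override_on_def f'_def fun_eq_iff)
      have "bij_betw (\<lambda>\<beta>. transpose b y0 \<circ> \<beta>)
          {\<beta>\<in>{\<beta>. \<beta> permutes V \<and> \<beta> b = y0}. absorbing (override_on f (w \<circ> \<beta>) V) T}
          {\<beta>\<in>{\<beta>. \<beta> permutes (V - {b})}.
             absorbing (override_on (f' b) ((w \<circ> transpose b y0) \<circ> \<beta>) (V - {b})) T}"
        using permutes_image_swap_bij[OF b y0(1)]
      proof (rule bij_betw_Collect)
        fix \<beta> assume "\<beta> \<in> {\<beta>. \<beta> permutes V \<and> \<beta> b = y0}"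
        then show "absorbing (override_on (f' b) ((w \<circ> transpose b y0) \<circ> (transpose b y0 \<circ> \<beta>)) (V - {b})) T
          \<longleftrightarrow> absorbing (override_on f (w \<circ> \<beta>) V) T"
          using eq[of \<beta>] by simp
      qed
      then have "card {\<beta>\<in>{\<beta>. \<beta> permutes V \<and> \<beta> b = y0}. absorbing (override_on f (w \<circ> \<beta>) V) T}
          = card {\<beta>\<in>{\<beta>. \<beta> permutes (V - {b})}.
             absorbing (override_on (f' b) ((w \<circ> transpose b y0) \<circ> \<beta>) (V - {b})) T}"
        by (rule bij_betw_same_card)
      then have "card (X b) = card ?Z" unfolding X_def mem_Collect_eq conj_assoc .
      also have "\<dots> = (if V - {b} = {} then 1 else fact (card (V - {b}) - 1) *
          card {y\<in>V - {b}. reaches (f' b) (V - {b}) T ((w \<circ> transpose b y0) y)})"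
      proof (rule Suc.hyps(1))
        show "n = card (V - {b})" using cV b fin by simp
        show "(V - {b}) \<inter> T = {}" using Suc.prems(2) by auto
        show "reaches (f' b) {} (T \<union> (V - {b})) x" for x
          unfolding f'_def by (rule reaches_upd_target[OF Suc.prems(3) b y0(2)])
      qed (use fin in auto)
      also have "card {y\<in>V - {b}. reaches (f' b) (V - {b}) T ((w \<circ> transpose b y0) y)}
          = card {y\<in>V - {y0}. reaches (f' b) (V - {b}) T (w y)}"
      proof -
        have "bij_betw (transpose b y0) (V - {b}) (V - {y0})"
          by (rule bij_betw_byWitness[where f' = "transpose b y0"])
            (use b y0(1) in \<open>auto simp: transpose_def\<close>)
        then have "bij_betw (transpose b y0)
           {y\<in>V - {b}. reaches (f' b) (V - {b}) T ((w \<circ> transpose b y0) y)}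
           {y\<in>V - {y0}. reaches (f' b) (V - {b}) T (w y)}"
          by (rule bij_betw_Collect) simp
        then show ?thesis by (rule bij_betw_same_card)
      qed
      finally have "card (X b) = (if V - {b} = {} then 1 else fact (card (V - {b}) - 1) *
          card {y\<in>V - {y0}. reaches (f' b) (V - {b}) T (w y)})" .
      moreover have "card (V - {b}) = n" using cV b fin by simp
      moreover have "V - {b} = {} \<longleftrightarrow> n = 0" using calculation(2) fin by auto
      ultimately show ?thesis by (simp only:)
    qed
    show ?thesis
    proof (cases "n = 0")
      case True
      then obtain v where "V = {v}" using cV by (auto simp: card_Suc_eq)
      then have "V = {y0}" using y0 by auto
      then have "{y\<in>V. reaches f V T (w y)} = {y0}" using y0 by auto
      then show ?thesis unfolding XU cU using True cX cV ne by simp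
    next
      case False
      have kpos: "k > 0" unfolding k_def using y0 fin by (auto simp: card_gt_0_iff)
      have "(\<Sum>b\<in>V. card {y\<in>V - {y0}. reaches (f' b) (V - {b}) T (w y)})
          = (\<Sum>y\<in>V - {y0}. card {b\<in>V. reaches (f' b) (V - {b}) T (w y)})"
        by (rule sum_card_filter_swap) (use fin in auto)
      \<comment> \<open>If \<open>w y\<close> already leads to \<open>T\<close>, then
        \<open>y\<close> is counted for all \<open>n + 1\<close> choices of \<open>b\<close>; every
        other \<open>y\<close> is counted for exactly one.\<close>
      also have "\<dots> = (\<Sum>y\<in>V - {y0}. if reaches f V T (w y) then Suc n else 1)"
      proof (rule sum.cong[OF refl])
        fix y assume "y \<in> V - {y0}"
        show "card {b\<in>V. reaches (f' b) (V - {b}) T (w y)} = (if reaches f V T (w y) then Suc n else 1)"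
        proof (cases "reaches f V T (w y)")
          case True
          then have "{b\<in>V. reaches (f' b) (V - {b}) T (w y)} = V"
            using reaches_upd by (auto simp: f'_def)
          then show ?thesis using True cV by simp
        next
          case False
          then show ?thesis unfolding f'_def
            using card_reaches_upd[OF Suc.prems(3) False y0(2) Suc.prems(2)] by simp
        qed
      qed
      also have "\<dots> = (\<Sum>y\<in>V - {y0}. 1 + (if reaches f V T (w y) then n else 0))"
        by (rule sum.cong) auto
      \<comment> \<open>Of the \<open>n\<close> points other than \<open>y0\<close>, exactly
        \<open>k - 1\<close> have a value leading to \<open>T\<close>, because \<open>y0\<close> is
        one of the \<open>k\<close>.\<close>
      also have "\<dots> = n + n * (k - 1)"
      proof -
        have "{y \<in> V - {y0}. reaches f V T (w y)} = {y\<in>V. reaches f V T (w y)} - {y0}" by auto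
        then have "card {y \<in> V - {y0}. reaches f V T (w y)} = k - 1"
          unfolding k_def using y0 fin by simp
        then show ?thesis using fin y0 cV by (simp only: sum.distrib sum.inter_filter[symmetric] finite_Diff) simp
      qed
      also have "\<dots> = n * k" using kpos by (cases k) auto
      finally have "(\<Sum>b\<in>V. card (X b)) = fact (n - 1) * (n * k)"
        using False cX by (simp add: sum_distrib_left[symmetric])
      also have "\<dots> = fact n * k" using False by (cases n) (auto simp: algebra_simps)
      finally show ?thesis unfolding XU cU using ne cV by (simp add: k_def)
    qed
  qed
qed

text \<open>Every visit to \<open>V\<close> continues at \<open>a\<close>, so the path from
  \<open>a\<close> must never step from \<open>V\<close> again. The factor counted in
  \<open>card_absorbing_permutations\<close> thereby becomes an absorption condition, to which the
  count for another block can be applied.\<close>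

lemma absorbing_override_const_iff:
  assumes "V \<noteq> {}" "V \<inter> T = {}"
  shows "absorbing (override_on f (\<lambda>_. a) V) T \<longleftrightarrow> reaches f V T a \<and> (\<forall>x. reaches f {} (T \<union> V) x)"
proof
  assume G: "absorbing (override_on f (\<lambda>_. a) V) T"
  obtain v where v: "v \<in> V" using assms by blast
  have "\<not> reaches f V T v" using v assms(2) by (auto simp: reaches_avoided_iff)
  then have "reaches f V T a"
    using G reaches_override[of "override_on f (\<lambda>_. a) V" T v V f]
    by (auto simp: absorbing_def override_on_def)
  then show "reaches f V T a \<and> (\<forall>x. reaches f {} (T \<union> V) x)"
    using absorbing_override_imp_reaches[OF G] by blast
next
  assume *: "reaches f V T a \<and> (\<forall>x. reaches f {} (T \<union> V) x)"
  have a: "reaches (override_on f (\<lambda>_. a) V) {} T a"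
    using conjunct1[OF *] by (rule reaches_mono) (auto simp: override_on_def)
  have "reaches (override_on f (\<lambda>_. a) V) {} T x" for x
    using spec[OF conjunct2[OF *], of x]
  proof induction
    case (target x)
    then show ?case using a by (cases "x \<in> V") (auto intro: reaches.intros simp: override_on_def)
  next
    case (step x)
    then show ?case using a by (cases "x \<in> V") (auto intro: reaches.step simp: override_on_def)
  qed
  then show "absorbing (override_on f (\<lambda>_. a) V) T" by (simp add: absorbing_def)
qed

text \<open>If some point reaches neither \<open>T\<close> nor \<open>B\<close>, both sides vanish.
  The identity thus holds for every \<open>f\<close> and can be used on one block after
  another.\<close>

lemma card_absorbing_block:
  assumes "finite B" "B \<noteq> {}" "B \<inter> T = {}"
  shows "card {\<beta>. \<beta> permutes B \<and> absorbing (override_on f (w \<circ> \<beta>) B) T} =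
         fact (card B - 1) * card {y\<in>B. absorbing (override_on f (\<lambda>_. w y) B) T}"
proof (cases "\<forall>x. reaches f {} (T \<union> B) x")
  case True
  then show ?thesis
    using card_absorbing_permutations[of B T f w] assms by (simp add: absorbing_override_const_iff)
next
  case False
  then have "\<not> absorbing (override_on f h B) T" for h
    using absorbing_override_imp_reaches by metis
  then show ?thesis by simp
qed

section \<open>From block-preserving permutations to choices of one point per block\<close>

lemma card_Collect_pairs:
  assumes "finite A" "finite B"
  shows "card {p \<in> A \<times> B. Q (fst p) (snd p)} = (\<Sum>b\<in>B. card {a\<in>A. Q a b})"
proof -
  have "{p \<in> A \<times> B. Q (fst p) (snd p)} = (\<lambda>(b, a). (a, b)) ` (SIGMA b:B. {a\<in>A. Q a b})"
    by force
  moreover have "inj_on (\<lambda>(b, a). (a, b)) (SIGMA b:B. {a\<in>A. Q a b})"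
    by (auto simp: inj_on_def)
  ultimately show ?thesis using assms by (simp add: card_image)
qed

text \<open>The set S_\<pi>, expressed by invariance of the blocks instead of by cycles; this form
  splits along blocks. The equivalence is \<open>S_part_eq_blockperms\<close>.\<close>

definition blockperms :: "'a set set \<Rightarrow> ('a \<Rightarrow> 'a) set" where
  "blockperms F = {\<beta>. \<beta> permutes \<Union>F \<and> (\<forall>B\<in>F. \<beta> ` B \<subseteq> B)}"

lemma finite_blockperms: "finite (\<Union>F) \<Longrightarrow> finite (blockperms F)"
  by (rule finite_subset[OF _ finite_permutations]) (auto simp: blockperms_def)

lemma perm_restrict_permutes:
  assumes "\<beta> permutes A" "finite B" "\<beta> ` B \<subseteq> B"
  shows "perm_restrict \<beta> B permutes B"
proof -
  have "inj_on \<beta> B" using permutes_inj_on[OF assms(1)] .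
  then have "bij_betw \<beta> B B"
    using assms(2,3) by (simp add: bij_betw_def endo_inj_surj)
  then have "bij_betw (perm_restrict \<beta> B) B B"
    by (rule bij_betw_cong[THEN iffD1, rotated]) (simp add: perm_restrict_def)
  then show ?thesis by (rule bij_imp_permutes) (simp add: perm_restrict_def)
qed

text \<open>The two factors have disjoint supports, so they are recovered by restricting the
  composition to \<open>B\<close> and to the union of the other blocks.\<close>

lemma blockperms_insert_bij:
  assumes "finite B" "finite (\<Union>F)" "B \<inter> \<Union>F = {}"
  shows "bij_betw (\<lambda>p. fst p \<circ> snd p) ({\<alpha>. \<alpha> permutes B} \<times> blockperms F) (blockperms (insert B F))"
proof (rule bij_betw_byWitness[where f' = "\<lambda>\<gamma>. (perm_restrict \<gamma> B, perm_restrict \<gamma> (\<Union>F))"])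
  have comp: "(\<alpha> \<circ> \<beta>) x = (if x \<in> B then \<alpha> x else \<beta> x)"
    if "\<alpha> permutes B" "\<beta> permutes \<Union>F" for \<alpha> \<beta> x
  proof (cases "x \<in> \<Union>F")
    case True
    then have "\<beta> x \<notin> B" "x \<notin> B" using permutes_in_image[OF that(2)] assms(3) by blast+
    then show ?thesis using permutes_not_in[OF that(1)] by simp
  next
    case False
    then show ?thesis using permutes_not_in[OF that(2)] permutes_not_in[OF that(1)] by simp
  qed
  show "\<forall>p\<in>{\<alpha>. \<alpha> permutes B} \<times> blockperms F.
      (perm_restrict (fst p \<circ> snd p) B, perm_restrict (fst p \<circ> snd p) (\<Union>F)) = p"
  proof
    fix p assume "p \<in> {\<alpha>. \<alpha> permutes B} \<times> blockperms F"
    then obtain \<alpha> \<beta> where p: "p = (\<alpha>, \<beta>)" "\<alpha> permutes B" "\<beta> permutes \<Union>F"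
      by (auto simp: blockperms_def)
    have "perm_restrict (\<alpha> \<circ> \<beta>) B = \<alpha>"
      using comp[OF p(2,3)] permutes_not_in[OF p(2)] by (auto simp: perm_restrict_def fun_eq_iff)
    moreover have "perm_restrict (\<alpha> \<circ> \<beta>) (\<Union>F) x = \<beta> x" for x
      using comp[OF p(2,3), of x] permutes_not_in[OF p(3), of x] assms(3)
      by (cases "x \<in> \<Union>F") (auto simp: perm_restrict_def)
    ultimately show "(perm_restrict (fst p \<circ> snd p) B, perm_restrict (fst p \<circ> snd p) (\<Union>F)) = p"
      using p(1) by (auto simp: fun_eq_iff)
  qed
  show "(\<lambda>p. fst p \<circ> snd p) ` ({\<alpha>. \<alpha> permutes B} \<times> blockperms F) \<subseteq> blockperms (insert B F)"
  proof
    fix \<gamma> assume "\<gamma> \<in> (\<lambda>p. fst p \<circ> snd p) ` ({\<alpha>. \<alpha> permutes B} \<times> blockperms F)"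
    then obtain \<alpha> \<beta> where p: "\<gamma> = \<alpha> \<circ> \<beta>" "\<alpha> permutes B" "\<beta> permutes \<Union>F" "\<forall>B\<in>F. \<beta> ` B \<subseteq> B"
      by (auto simp: blockperms_def)
    have "\<gamma> permutes \<Union>(insert B F)" unfolding p(1)
      using p(2,3) by (intro permutes_compose) (auto elim: permutes_subset)
    moreover have "\<gamma> ` B \<subseteq> B" using comp[OF p(2,3)] p(1) permutes_in_image[OF p(2)] by auto
    moreover have "\<gamma> ` C \<subseteq> C" if "C \<in> F" for C
    proof
      fix y assume "y \<in> \<gamma> ` C"
      then obtain x where x: "x \<in> C" "y = \<gamma> x" by blast
      then have "x \<notin> B" using that assms(3) by blast
      then have "y = \<beta> x" using x comp[OF p(2,3), of x] p(1) by simp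
      then show "y \<in> C" using p(4) that x by blast
    qed
    ultimately show "\<gamma> \<in> blockperms (insert B F)" by (auto simp: blockperms_def)
  qed
  show "\<forall>\<gamma>\<in>blockperms (insert B F).
      fst (perm_restrict \<gamma> B, perm_restrict \<gamma> (\<Union>F)) \<circ> snd (perm_restrict \<gamma> B, perm_restrict \<gamma> (\<Union>F)) = \<gamma>"
  proof
    fix \<gamma> assume "\<gamma> \<in> blockperms (insert B F)"
    then have g: "\<gamma> permutes B \<union> \<Union>F" "\<gamma> ` B \<subseteq> B" "\<gamma> ` \<Union>F \<subseteq> \<Union>F"
      by (auto simp: blockperms_def) blast
    have "perm_restrict \<gamma> B \<circ> perm_restrict \<gamma> (\<Union>F) = perm_restrict \<gamma> (B \<union> \<Union>F)"
      using g assms by (intro perm_restrict_union perm_restrict_permutes[OF g(1)]) auto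
    then show "fst (perm_restrict \<gamma> B, perm_restrict \<gamma> (\<Union>F)) \<circ> snd (perm_restrict \<gamma> B, perm_restrict \<gamma> (\<Union>F)) = \<gamma>"
      using g(1) by simp
  qed
  show "(\<lambda>\<gamma>. (perm_restrict \<gamma> B, perm_restrict \<gamma> (\<Union>F))) ` blockperms (insert B F)
      \<subseteq> {\<alpha>. \<alpha> permutes B} \<times> blockperms F"
  proof clarify
    fix \<gamma> assume "\<gamma> \<in> blockperms (insert B F)"
    then have g: "\<gamma> permutes B \<union> \<Union>F" "\<gamma> ` B \<subseteq> B" "\<gamma> ` \<Union>F \<subseteq> \<Union>F" "\<forall>C\<in>F. \<gamma> ` C \<subseteq> C"
      by (auto simp: blockperms_def) blast
    have "perm_restrict \<gamma> B permutes B" "perm_restrict \<gamma> (\<Union>F) permutes \<Union>F"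
      using g assms by (auto intro!: perm_restrict_permutes[OF g(1)])
    moreover have "perm_restrict \<gamma> (\<Union>F) ` C \<subseteq> C" if "C \<in> F" for C
      using g(4) that by (auto simp: perm_restrict_def)
    ultimately show "perm_restrict \<gamma> B \<in> {\<alpha>. \<alpha> permutes B} \<and> perm_restrict \<gamma> (\<Union>F) \<in> blockperms F"
      by (auto simp: blockperms_def)
  qed
qed

lemma card_blockperms:
  assumes "finite F" "\<And>B. B \<in> F \<Longrightarrow> finite B" "disjoint F"
  shows "card (blockperms F) = (\<Prod>B\<in>F. fact (card B))"
  using assms
proof (induction F)
  case empty
  have "blockperms ({} :: 'a set set) = {id}" by (auto simp: blockperms_def)
  then show ?case by simp
next
  case (insert B F)
  have d: "B \<inter> \<Union>F = {}" using insert.prems(2) insert.hyps(2) by (auto simp: disjoint_def)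
  have "card (blockperms (insert B F)) = card ({\<alpha>. \<alpha> permutes B} \<times> blockperms F)"
    using blockperms_insert_bij[OF _ _ d] insert by (intro bij_betw_same_card[symmetric]) auto
  also have "\<dots> = fact (card B) * card (blockperms F)"
    using insert by (simp add: card_cartesian_product card_permutations)
  finally show ?case using insert by (simp add: pairwise_insert)
qed

lemma PiE_insert_bij:
  assumes "i \<notin> I"
  shows "bij_betw (\<lambda>p. (snd p)(i := fst p)) (A i \<times> Pi\<^sub>E I A) (Pi\<^sub>E (insert i I) A)"
proof -
  have "inj_on (\<lambda>p. (snd p)(i := fst p)) (A i \<times> Pi\<^sub>E I A)"
    using inj_combinator[OF assms, of A] by (simp add: case_prod_beta')
  then show ?thesis
    by (auto simp: bij_betw_def PiE_insert_eq case_prod_beta')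
qed

text \<open>\<open>\<kappa>\<close> names the block of a point, so a choice \<open>s\<close> of one
  point per block sends a whole block to one value of \<open>w\<close>. Each block in turn trades
  its permutations for a chosen point, at the cost of a factor (|B| - 1)!.\<close>

theorem card_absorbing_blockperms:
  fixes f w :: "'a \<Rightarrow> 'a"
  assumes "finite F" "\<And>B. B \<in> F \<Longrightarrow> finite B \<and> B \<noteq> {}" "\<Union>F \<inter> T = {}"
    and "\<And>B x. B \<in> F \<Longrightarrow> x \<in> B \<Longrightarrow> \<kappa> x = B"
  shows "card {\<beta>\<in>blockperms F. absorbing (override_on f (w \<circ> \<beta>) (\<Union>F)) T} =
    (\<Prod>B\<in>F. fact (card B - 1)) *
    card {s\<in>(\<Pi>\<^sub>E B\<in>F. B). absorbing (override_on f (\<lambda>x. w (s (\<kappa> x))) (\<Union>F)) T}"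
  using assms
proof (induction F arbitrary: f)
  case empty
  have "blockperms ({} :: 'a set set) = {id}" by (auto simp: blockperms_def)
  then show ?case by (cases "absorbing f T") (auto simp: override_on_def)
next
  case (insert B F)
  have finF: "finite (\<Union>F)" and finB: "finite B" "B \<noteq> {}" using insert by auto
  have d: "B \<inter> \<Union>F = {}"
  proof (rule equals0I)
    fix x assume "x \<in> B \<inter> \<Union>F"
    then obtain C where "x \<in> B" "x \<in> C" "C \<in> F" by blast
    then have "B = C" using insert.prems(3)[of B x] insert.prems(3)[of C x] by simp
    then show False using \<open>C \<in> F\<close> insert.hyps(2) by simp
  qed
  let ?G = "\<lambda>\<beta> h. absorbing (override_on (override_on f (w \<circ> \<beta>) (\<Union>F)) h B) T"
  let ?N = "\<lambda>y s. absorbing (override_on (override_on f (\<lambda>_. w y) B) (\<lambda>x. w (s (\<kappa> x))) (\<Union>F)) T"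
  have finP: "finite (Pi\<^sub>E F (\<lambda>B. B))" using insert by (intro finite_PiE) auto
  have swap: "override_on (override_on f g (\<Union>F)) h B = override_on (override_on f h B) g (\<Union>F)" for g h
    using d by (auto simp: override_on_def fun_eq_iff)
  have "bij_betw (\<lambda>p. fst p \<circ> snd p)
      {p\<in>{\<alpha>. \<alpha> permutes B} \<times> blockperms F. ?G (snd p) (w \<circ> fst p)}
      {\<beta>\<in>blockperms (insert B F). absorbing (override_on f (w \<circ> \<beta>) (\<Union>(insert B F))) T}"
  proof (rule bij_betw_Collect[OF blockperms_insert_bij[OF finB(1) finF d]])
    fix p assume "p \<in> {\<alpha>. \<alpha> permutes B} \<times> blockperms F"
    then obtain \<alpha> \<beta> where p: "p = (\<alpha>, \<beta>)" "\<alpha> permutes B" "\<beta> permutes \<Union>F"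
      by (auto simp: blockperms_def)
    have "override_on f (w \<circ> (\<alpha> \<circ> \<beta>)) (\<Union>(insert B F)) x
        = override_on (override_on f (w \<circ> \<beta>) (\<Union>F)) (w \<circ> \<alpha>) B x" for x
    proof (cases "x \<in> \<Union>F")
      case True
      then have "x \<notin> B" "\<beta> x \<notin> B" using d permutes_in_image[OF p(3), of x] by blast+
      then show ?thesis using True permutes_not_in[OF p(2)] by (simp add: override_on_def)
    next
      case False
      then show ?thesis using permutes_not_in[OF p(3) False] by (simp add: override_on_def)
    qed
    then have "override_on f (w \<circ> (\<alpha> \<circ> \<beta>)) (\<Union>(insert B F))
        = override_on (override_on f (w \<circ> \<beta>) (\<Union>F)) (w \<circ> \<alpha>) B" by (rule ext)
    then show "absorbing (override_on f (w \<circ> (fst p \<circ> snd p)) (\<Union>(insert B F))) T \<longleftrightarrow> ?G (snd p) (w \<circ> fst p)"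
      by (simp only: p(1) fst_conv snd_conv)
  qed
  then have "card {\<beta>\<in>blockperms (insert B F). absorbing (override_on f (w \<circ> \<beta>) (\<Union>(insert B F))) T}
      = card {p\<in>{\<alpha>. \<alpha> permutes B} \<times> blockperms F. ?G (snd p) (w \<circ> fst p)}"
    by (rule bij_betw_same_card[symmetric])
  also have "\<dots> = (\<Sum>\<beta>\<in>blockperms F. card {\<alpha>\<in>{\<alpha>. \<alpha> permutes B}. ?G \<beta> (w \<circ> \<alpha>)})"
    by (rule card_Collect_pairs) (use finB finF in \<open>auto simp: finite_permutations finite_blockperms\<close>)
  \<comment> \<open>The permutation \<open>\<beta>\<close> of the other blocks is held fixed and
    belongs to the base map while \<open>B\<close> is treated.\<close>
  also have "\<dots> = (\<Sum>\<beta>\<in>blockperms F. fact (card B - 1) * card {y\<in>B. ?G \<beta> (\<lambda>_. w y)})"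
    using card_absorbing_block[of B T] finB insert.prems(2) by (intro sum.cong) (auto simp: Int_Un_distrib2)
  also have "\<dots> = fact (card B - 1) * (\<Sum>y\<in>B. card {\<beta>\<in>blockperms F. ?G \<beta> (\<lambda>_. w y)})"
    unfolding sum_distrib_left[symmetric]
    by (rule arg_cong[where f = "(*) (fact (card B - 1))"],
        rule sum_card_filter_swap[OF finite_blockperms[OF finF] finB(1)])
  \<comment> \<open>Now \<open>B\<close> is constant and belongs to the base map: by disjointness
    the two overrides commute, and the induction hypothesis applies to \<open>f\<close> overridden
    by \<open>w y\<close> on \<open>B\<close>.\<close>
  also have "(\<Sum>y\<in>B. card {\<beta>\<in>blockperms F. ?G \<beta> (\<lambda>_. w y)})
      = (\<Sum>y\<in>B. (\<Prod>B\<in>F. fact (card B - 1)) * card {s\<in>(\<Pi>\<^sub>E B\<in>F. B). ?N y s})"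
    unfolding swap using insert.prems by (intro sum.cong refl insert.IH) auto
  also have "\<dots> = (\<Prod>B\<in>F. fact (card B - 1)) * (\<Sum>y\<in>B. card {s\<in>(\<Pi>\<^sub>E B\<in>F. B). ?N y s})"
    by (simp only: sum_distrib_left)
  also have "(\<Sum>y\<in>B. card {s\<in>(\<Pi>\<^sub>E B\<in>F. B). ?N y s})
      = (\<Sum>s\<in>(\<Pi>\<^sub>E B\<in>F. B). card {y\<in>B. ?N y s})"
    by (rule sum_card_filter_swap) (use finB finP in auto)
  also have "\<dots> = card {p\<in>B \<times> (\<Pi>\<^sub>E B\<in>F. B). ?N (fst p) (snd p)}"
    by (rule card_Collect_pairs[symmetric]) (use finB finP in auto)
  also have "\<dots> = card {s\<in>(\<Pi>\<^sub>E B\<in>insert B F. B).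
      absorbing (override_on f (\<lambda>x. w (s (\<kappa> x))) (\<Union>(insert B F))) T}"
  proof (rule bij_betw_same_card, rule bij_betw_Collect[OF PiE_insert_bij[OF insert.hyps(2)]])
    fix p assume "p \<in> B \<times> (\<Pi>\<^sub>E B\<in>F. B)"
    have "override_on f (\<lambda>x. w (((snd p)(B := fst p)) (\<kappa> x))) (\<Union>(insert B F)) x
      = override_on (override_on f (\<lambda>_. w (fst p)) B) (\<lambda>x. w (snd p (\<kappa> x))) (\<Union>F) x" for x
    proof -
      consider "x \<in> B" | C where "x \<in> C" "C \<in> F" | "x \<notin> \<Union>(insert B F)" by blast
      then show ?thesis
      proof cases
        case 1
        then have "\<kappa> x = B" "x \<notin> \<Union>F" using insert.prems(3) d by auto
        then show ?thesis using 1 by (simp add: override_on_def)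
      next
        case 2
        then have "\<kappa> x = C" "C \<noteq> B" "x \<in> \<Union>F" using insert.prems(3) insert.hyps(2) by auto
        then show ?thesis by (simp add: override_on_def)
      qed (simp add: override_on_def)
    qed
    then have "override_on f (\<lambda>x. w (((snd p)(B := fst p)) (\<kappa> x))) (\<Union>(insert B F))
      = override_on (override_on f (\<lambda>_. w (fst p)) B) (\<lambda>x. w (snd p (\<kappa> x))) (\<Union>F)" by (rule ext)
    then show "absorbing (override_on f (\<lambda>x. w (((snd p)(B := fst p)) (\<kappa> x))) (\<Union>(insert B F))) T
      \<longleftrightarrow> ?N (fst p) (snd p)" by (simp only:)
  qed
  finally show ?case using insert.hyps by simp
qed

section \<open>Full cycles as absorbing maps\<close>

lemma absorbing_cong:
  assumes "\<And>x. x \<notin> T \<Longrightarrow> f x = g x"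
  shows "absorbing f T \<longleftrightarrow> absorbing g T"
proof
  show "absorbing g T" if "absorbing f T"
    using that assms unfolding absorbing_def by (auto intro: reaches_mono[of f])
  show "absorbing f T" if "absorbing g T"
    using that assms unfolding absorbing_def by (auto intro: reaches_mono[of g])
qed

text \<open>Redirecting the arc into \<open>a\<close> to the outside point \<open>z\<close> opens
  the cycle through \<open>a\<close> into a path leaving \<open>A\<close>. Any other cycle survives
  and traps its points, so absorption means that there is none.\<close>

lemma cyclic_on_iff_absorbing:
  assumes "\<sigma> permutes A" "finite A" "a \<in> A" "z \<notin> A"
  shows "cyclic_on \<sigma> A \<longleftrightarrow> absorbing (\<lambda>x. if \<sigma> x = a then z else \<sigma> x) (- A)"
proof
  let ?f = "\<lambda>x. if \<sigma> x = a then z else \<sigma> x"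
  have perm: "permutation \<sigma>" using assms by (auto simp: permutation_permutes)
  {
    assume cyc: "cyclic_on \<sigma> A"
    have reach: "reaches ?f {} (- A) x" if "(\<sigma> ^^ n) x = a" "n > 0" for n x
      using that
    proof (induction n arbitrary: x)
      case (Suc n)
      show ?case
      proof (cases "\<sigma> x = a")
        case True
        then show ?thesis
          using assms(4) reaches.target[of z "- A"] by (auto intro: reaches.step)
      next
        case False
        then have "n > 0" using Suc.prems by (cases n) auto
        then have "reaches ?f {} (- A) (\<sigma> x)"
          using Suc by (simp add: funpow_swap1)
        then show ?thesis using False by (auto intro: reaches.step)
      qed
    qed simp
    show "absorbing ?f (- A)" unfolding absorbing_def
    proof
      fix x
      show "reaches ?f {} (- A) x"
      proof (cases "x \<in> A")
        case True
        then have "a \<in> orbit \<sigma> x" using cyc assms(3) by (auto simp: cyclic_on_alldef)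
        then show ?thesis using reach by (auto simp: orbit_altdef)
      qed (auto intro: reaches.target)
    qed
  }
  {
    assume G: "absorbing ?f (- A)"
    have "a \<in> orbit \<sigma> x" if "x \<in> A" "reaches ?f {} (- A) x" for x
      using that(2,1)
    proof induction
      case (step x)
      show ?case
      proof (cases "\<sigma> x = a")
        case True
        then show ?thesis using orbit.base[of \<sigma> x] by simp
      next
        case False
        then have "a \<in> orbit \<sigma> (\<sigma> x)"
          using step permutes_in_image[OF assms(1)] by auto
        then show ?thesis by (rule orbit_subset)
      qed
    qed simp
    then have "x \<in> orbit \<sigma> a" if "x \<in> A" for x
      using that G orbit_swap[OF permutation_self_in_orbit[OF perm]] by (auto simp: absorbing_def)
    then have "A = orbit \<sigma> a" using permutes_orbit_subset[OF assms(1,3)] by blast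
    then show "cyclic_on \<sigma> A" using assms(3) by (rule cyclic_on_singleI[rotated])
  }
qed

text \<open>By injectivity of \<open>c\<close>, changing \<open>c\<close> at \<open>r\<close>
  redirects exactly the arc of \<open>c \<circ> \<beta>\<close> that enters \<open>c r\<close>.
  Prescribing \<open>f\<close> only on \<open>A\<close> allows maps of the shape
  \<open>override_on\<close> in its place.\<close>

lemma cyclic_on_comp_iff_absorbing:
  assumes "c permutes A" "\<beta> permutes A" "finite A" "r \<in> A" "z \<notin> A"
    and "\<And>x. x \<in> A \<Longrightarrow> f x = (c(r := z)) (\<beta> x)"
  shows "cyclic_on (c \<circ> \<beta>) A \<longleftrightarrow> absorbing f (- A)"
proof -
  have "cyclic_on (c \<circ> \<beta>) A \<longleftrightarrow> absorbing (\<lambda>x. if (c \<circ> \<beta>) x = c r then z else (c \<circ> \<beta>) x) (- A)"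
    using assms by (intro cyclic_on_iff_absorbing permutes_compose) (auto simp: permutes_in_image)
  also have "\<dots> \<longleftrightarrow> absorbing f (- A)"
    by (rule absorbing_cong) (use assms(6) permutes_inj[OF assms(1)] in \<open>auto simp: inj_eq\<close>)
  finally show ?thesis .
qed

text \<open>The forest count with \<open>V = A\<close> and \<open>w = id(a := z)\<close>: only
  \<open>y = a\<close> has a value outside \<open>A\<close>.\<close>

lemma card_cyclic_permutations:
  assumes "finite A" "a \<in> A" "z \<notin> A"
  shows "card {c. c permutes A \<and> cyclic_on c A} = fact (card A - 1)"
proof -
  have "cyclic_on c A \<longleftrightarrow> absorbing (override_on id (id(a := z) \<circ> c) A) (- A)" if "c permutes A" for c
    using cyclic_on_comp_iff_absorbing[OF permutes_id that assms, of "override_on id (id(a := z) \<circ> c) A"]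
    by (simp add: comp_def override_on_def)
  then have "{c. c permutes A \<and> cyclic_on c A}
      = {c. c permutes A \<and> absorbing (override_on id (id(a := z) \<circ> c) A) (- A)}" by blast
  also have "card \<dots> = fact (card A - 1) * card {y\<in>A. reaches id A (- A) ((id(a := z)) y)}"
  proof -
    have "reaches id {} (- A \<union> A) x" for x by (rule reaches.target) simp
    then show ?thesis using assms by (subst card_absorbing_permutations) auto
  qed
  also have "{y\<in>A. reaches id A (- A) ((id(a := z)) y)} = {a}"
    using assms by (auto simp: reaches_avoided_iff reaches.target)
  finally show ?thesis by simp
qed

section \<open>A fixed set partition, averaged over all full cycles\<close>

text \<open>\<open>r\<close> is the root at which cycles are opened, \<open>R\<close> its block, and
  \<open>z\<close> the exit outside \<open>A\<close>.\<close>

locale rooted_blocks =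
  fixes A :: "'a set" and P :: "'a set set" and \<kappa> :: "'a \<Rightarrow> 'a set" and R :: "'a set" and r z :: 'a
  assumes finite_A: "finite A" and part: "partition_on A P"
    and \<kappa>: "\<And>B x. B \<in> P \<Longrightarrow> x \<in> B \<Longrightarrow> \<kappa> x = B"
    and R: "R \<in> P" and r: "r \<in> R" and z: "z \<notin> A"
begin

definition selections :: "('a set \<Rightarrow> 'a) set" where
  "selections = {s \<in> (\<Pi>\<^sub>E B\<in>P. B). s R = r}"

text \<open>This is what \<open>c \<circ> \<beta>\<close> turns into when \<open>\<beta>\<close> is
  replaced by a selection: each point jumps to the selected point of its block and then follows
  \<open>c\<close>, with \<open>r\<close> leaving through \<open>z\<close>.\<close>

definition exit_map :: "('a set \<Rightarrow> 'a) \<Rightarrow> ('a \<Rightarrow> 'a) \<Rightarrow> 'a \<Rightarrow> 'a" where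
  "exit_map s c = override_on id (\<lambda>x. (c(r := z)) (s (\<kappa> x))) A"

definition exits_absorb :: "('a set \<Rightarrow> 'a) \<Rightarrow> ('a \<Rightarrow> 'a) \<Rightarrow> bool" where
  "exits_absorb s c \<longleftrightarrow> absorbing (exit_map s c) (- A)"

lemma finite_P: "finite P"
  using finite_A part by (rule finite_elements)

lemma Union_P: "\<Union>P = A"
  using part by (simp add: partition_on_def)

lemma block:
  assumes "B \<in> P"
  shows "finite B" "B \<noteq> {}" "B \<subseteq> A"
proof -
  show "B \<subseteq> A" using assms Union_P by blast
  then show "finite B" using finite_A by (rule finite_subset)
  show "B \<noteq> {}" using assms part by (auto simp: partition_on_def)
qed

lemma r_in_A: "r \<in> A"
  using R r Union_P by blast

lemma \<kappa>_block: "x \<in> A \<Longrightarrow> \<kappa> x \<in> P \<and> x \<in> \<kappa> x"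
  using Union_P \<kappa> by (metis UnionE)

lemma selection_in_block:
  assumes "s \<in> (\<Pi>\<^sub>E B\<in>P. B)" "x \<in> A"
  shows "s (\<kappa> x) \<in> \<kappa> x" "s (\<kappa> x) \<in> A"
  using assms \<kappa>_block[OF assms(2)] Union_P by (auto simp: PiE_iff)

lemma selection_eq_r_iff:
  assumes "s \<in> selections" "x \<in> A"
  shows "s (\<kappa> x) = r \<longleftrightarrow> x \<in> R"
proof
  have s: "s (\<kappa> x) \<in> \<kappa> x" using assms by (simp add: selection_in_block(1) selections_def)
  show "x \<in> R" if "s (\<kappa> x) = r"
    using that s \<kappa>_block[OF assms(2)] \<kappa>[OF R r] \<kappa>[of "\<kappa> x" r] by auto
  show "s (\<kappa> x) = r" if "x \<in> R"
    using \<kappa>[OF R that] assms(1) by (simp add: selections_def)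
qed

text \<open>The only way out of \<open>A\<close> is \<open>z\<close>, entered only through
  \<open>r\<close>. If \<open>R\<close> selects another point, no block selects \<open>r\<close> and
  every path starting in \<open>A\<close> stays there.\<close>

lemma exits_absorb_root:
  assumes "c permutes A" "s \<in> (\<Pi>\<^sub>E B\<in>P. B)" "exits_absorb s c"
  shows "s \<in> selections"
proof (rule ccontr)
  assume "s \<notin> selections"
  then have sR: "s R \<noteq> r" using assms(2) by (simp add: selections_def)
  have "x \<notin> A" if "reaches (exit_map s c) {} (- A) x" for x
    using that
  proof induction
    case (step x)
    show ?case
    proof
      assume x: "x \<in> A"
      have s: "s (\<kappa> x) \<in> \<kappa> x" "s (\<kappa> x) \<in> A" using selection_in_block[OF assms(2) x] .
      have "s (\<kappa> x) \<noteq> r"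
      proof
        assume "s (\<kappa> x) = r"
        then have "r \<in> \<kappa> x" using s by simp
        then have "\<kappa> x = R" using \<kappa>_block[OF x] \<kappa>[OF R r] \<kappa>[of "\<kappa> x" r] by simp
        then show False using \<open>s (\<kappa> x) = r\<close> sR by simp
      qed
      then have "exit_map s c x \<in> A"
        using x s permutes_in_image[OF assms(1)] by (simp add: exit_map_def override_on_def)
      then show False using step by simp
    qed
  qed simp
  then show False using assms(3) r_in_A by (auto simp: exits_absorb_def absorbing_def)
qed

text \<open>The block-by-block count with \<open>w = c(r := z)\<close> and target
  \<open>- A\<close>; by \<open>exits_absorb_root\<close> only selections with root \<open>r\<close>
  survive.\<close>

lemma card_cyclic_blockperms:
  assumes "c permutes A"
  shows "card {\<beta>\<in>blockperms P. cyclic_on (c \<circ> \<beta>) A}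
    = (\<Prod>B\<in>P. fact (card B - 1)) * card {s\<in>selections. exits_absorb s c}"
proof -
  have "cyclic_on (c \<circ> \<beta>) A \<longleftrightarrow> absorbing (override_on id (c(r := z) \<circ> \<beta>) (\<Union>P)) (- A)"
    if "\<beta> \<in> blockperms P" for \<beta>
    using that by (intro cyclic_on_comp_iff_absorbing[OF assms _ finite_A r_in_A z])
      (auto simp: blockperms_def Union_P override_on_def)
  then have "{\<beta>\<in>blockperms P. cyclic_on (c \<circ> \<beta>) A}
      = {\<beta>\<in>blockperms P. absorbing (override_on id (c(r := z) \<circ> \<beta>) (\<Union>P)) (- A)}" by blast
  also have "card \<dots> = (\<Prod>B\<in>P. fact (card B - 1)) *
      card {s\<in>(\<Pi>\<^sub>E B\<in>P. B). absorbing (override_on id (\<lambda>x. (c(r := z)) (s (\<kappa> x))) (\<Union>P)) (- A)}"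
    by (rule card_absorbing_blockperms) (use finite_P block Union_P \<kappa> in auto)
  also have "{s\<in>(\<Pi>\<^sub>E B\<in>P. B). absorbing (override_on id (\<lambda>x. (c(r := z)) (s (\<kappa> x))) (\<Union>P)) (- A)}
      = {s\<in>(\<Pi>\<^sub>E B\<in>P. B). exits_absorb s c}"
    by (simp only: Union_P exits_absorb_def exit_map_def)
  also have "\<dots> = {s\<in>selections. exits_absorb s c}"
    using exits_absorb_root[OF assms] by (auto simp: selections_def)
  finally show ?thesis .
qed

text \<open>The choice in \<open>R\<close> is forced and the others are free; the factor
  \<open>card R\<close> restores the full product without a division.\<close>

lemma card_selections: "card selections * card R = (\<Prod>B\<in>P. card B)"
proof -
  have "selections = (\<Pi>\<^sub>E B\<in>P. if B = R then {r} else B)"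
    using R r by (auto simp: selections_def PiE_iff extensional_def split: if_splits)
  then have "card selections = (\<Prod>B\<in>P. card (if B = R then {r} else B))"
    using finite_P by (simp add: card_PiE)
  also have "\<dots> = (\<Prod>B\<in>P - {R}. card B)"
    using finite_P R by (simp add: prod.remove[of P R])
  finally show ?thesis using finite_P R by (simp add: prod.remove[of P R] mult.commute)
qed

text \<open>Both sides iterate the same two maps, selection and \<open>c\<close>, in opposite order; the right-hand side has
  \<open>c\<close> in the position to which card_absorbing_permutations applies.\<close>
lemma exits_absorb_iff:
  assumes s: "s \<in> selections" and c: "c permutes A"
  defines "w \<equiv> \<lambda>x. if x \<in> R then z else s (\<kappa> x)"
  shows "exits_absorb s c \<longleftrightarrow> absorbing (override_on id (w \<circ> c) A) (- A)"
proof -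
  define F where "F = override_on id (w \<circ> c) A"
  have F: "F x = w (c x)" if "x \<in> A" for x using that by (simp add: F_def override_on_def)
  have sP: "s \<in> (\<Pi>\<^sub>E B\<in>P. B)" using s by (simp add: selections_def)
  note sel = selection_in_block[OF sP] and in_A = permutes_in_image[OF c]
  have exit_R: "exit_map s c x = z" if "x \<in> R" for x
    using that selection_eq_r_iff[OF s, of x] block[OF R] by (auto simp: exit_map_def override_on_def)
  have exit_not_R: "exit_map s c x = c (s (\<kappa> x))" if "x \<in> A" "x \<notin> R" for x
    using that selection_eq_r_iff[OF s, of x] by (auto simp: exit_map_def override_on_def)
  have z': "reaches f {} (- A) z" for f using z by (auto intro: reaches.target)
  have R': "reaches (exit_map s c) {} (- A) x" if "x \<in> R" for x
    using that z' by (auto intro: reaches.step simp: exit_R)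
  have "exits_absorb s c" if G: "absorbing F (- A)"
  proof -
    \<comment> \<open>The induction follows the selected points. If \<open>y\<close> is selected for
      \<open>x\<close> outside \<open>R\<close>, then \<open>exit_map\<close> moves \<open>x\<close>
      to \<open>c y\<close>; either \<open>c y\<close> lies in \<open>R\<close> and exits next, or
      its selected point is \<open>F y\<close>.\<close>
    have *: "\<forall>x\<in>A. s (\<kappa> x) = y \<longrightarrow> reaches (exit_map s c) {} (- A) x"
      if "reaches F {} (- A) y" for y
      using that
    proof induction
      case (target y)
      then show ?case using sel by auto
    next
      case (step y)
      show ?case
      proof (intro ballI impI)
        fix x assume x: "x \<in> A" "s (\<kappa> x) = y"
        show "reaches (exit_map s c) {} (- A) x"
        proof (cases "x \<in> R")
          case False
          have y: "y \<in> A" "c y \<in> A" using sel x in_A by auto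
          have "reaches (exit_map s c) {} (- A) (c y)"
          proof (cases "c y \<in> R")
            case False
            then have "F y = s (\<kappa> (c y))" using y F by (simp add: w_def)
            then show ?thesis using step.IH y by simp
          qed (rule R')
          then show ?thesis using exit_not_R[OF x(1) False] x(2) by (auto intro: reaches.step)
        qed (rule R')
      qed
    qed
    show ?thesis unfolding exits_absorb_def absorbing_def
    proof
      fix x
      show "reaches (exit_map s c) {} (- A) x"
        using * G by (cases "x \<in> A") (auto simp: absorbing_def intro: reaches.target)
    qed
  qed
  moreover have "absorbing F (- A)" if G: "exits_absorb s c"
  proof -
    \<comment> \<open>Conversely, a path of \<open>exit_map\<close> from \<open>x\<close> is
      shadowed by a path of \<open>F\<close> from \<open>w x\<close>, the selected point of
      \<open>x\<close>, or \<open>z\<close> when \<open>x\<close> lies in \<open>R\<close>.\<close>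
    have *: "x \<in> A \<longrightarrow> reaches F {} (- A) (w x)" if "reaches (exit_map s c) {} (- A) x" for x
      using that
    proof induction
      case (step x)
      show ?case
      proof
        assume x: "x \<in> A"
        show "reaches F {} (- A) (w x)"
        proof (cases "x \<in> R")
          case True
          then show ?thesis using z' by (simp add: w_def)
        next
          case False
          then have w: "w x = s (\<kappa> x)" "w x \<in> A" using sel x by (auto simp: w_def)
          then have "reaches F {} (- A) (w (c (w x)))"
            using step.IH exit_not_R[OF x False] in_A by simp
          moreover have "F (w x) = w (c (w x))" using w F by simp
          ultimately show ?thesis using reaches.step[of "w x" "{}" F "- A"] by simp
        qed
      qed
    qed simp
    show ?thesis unfolding absorbing_def
    proof
      fix x
      show "reaches F {} (- A) x"
      proof (cases "x \<in> A")
        case True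
        then have "reaches F {} (- A) (F x)"
          using * G in_A by (simp add: exits_absorb_def absorbing_def F)
        then show ?thesis by (auto intro: reaches.step)
      qed (auto intro: reaches.target)
    qed
  qed
  ultimately show ?thesis unfolding F_def by blast
qed

text \<open>After the exchange of order in \<open>exits_absorb_iff\<close>, the forest count applies
  with \<open>V = A\<close>; the values of \<open>?w\<close> outside \<open>A\<close> are those at
  the points of \<open>R\<close>.\<close>

lemma card_exits_absorb:
  assumes s: "s \<in> selections"
  shows "card {c. c permutes A \<and> exits_absorb s c} = fact (card A - 1) * card R"
proof -
  let ?w = "\<lambda>x. if x \<in> R then z else s (\<kappa> x)"
  have sP: "s \<in> (\<Pi>\<^sub>E B\<in>P. B)" using s by (simp add: selections_def)
  have "{c. c permutes A \<and> exits_absorb s c}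
      = {c. c permutes A \<and> absorbing (override_on id (?w \<circ> c) A) (- A)}"
    using exits_absorb_iff[OF s] by blast
  also have "card \<dots> = fact (card A - 1) * card {y\<in>A. reaches id A (- A) (?w y)}"
  proof -
    have "reaches id {} (- A \<union> A) x" for x by (rule reaches.target) simp
    then show ?thesis using finite_A r_in_A by (subst card_absorbing_permutations) auto
  qed
  also have "{y\<in>A. reaches id A (- A) (?w y)} = R"
  proof -
    have "reaches id A (- A) (?w y) \<longleftrightarrow> y \<in> R" if "y \<in> A" for y
      using selection_in_block(2)[OF sP that] z
      by (cases "y \<in> R") (auto simp: reaches_avoided_iff reaches.target)
    then show ?thesis using block[OF R] by blast
  qed
  finally show ?thesis .
qed

text \<open>\<open>exit_map s c\<close> sees \<open>c\<close> only at the selected points other than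
  \<open>r\<close>. Composing \<open>c\<close> with permutations of the remaining set
  \<open>V\<close> keeps the exit condition, and the forest count makes (|V| - 1)! of the |V|!
  compositions cyclic.\<close>

lemma card_cyclic_exits_absorb:
  assumes s: "s \<in> selections"
  shows "(card A - card P + 1) * card {c. c permutes A \<and> cyclic_on c A \<and> exits_absorb s c}
    = card {c. c permutes A \<and> exits_absorb s c}"
proof -
  \<comment> \<open>The root \<open>r\<close> stays in \<open>V\<close>: although selected, its
    value is replaced by \<open>z\<close>. This leaves \<open>card A - (card P - 1)\<close>
    points.\<close>
  define V where "V = A - s ` (P - {R})"
  have sP: "s B \<in> B" if "B \<in> P" for B using s that by (auto simp: selections_def PiE_iff)
  have sub: "s ` (P - {R}) \<subseteq> A" using sP Union_P by blast
  have "inj_on s P"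
    using sP \<kappa> by (metis inj_onI)
  then have inj: "inj_on s (P - {R})" by (rule inj_on_subset) auto
  have rV: "r \<in> V"
  proof -
    have "r \<noteq> s B" if "B \<in> P - {R}" for B
      using that sP[of B] \<kappa>[of B r] \<kappa>[OF R r] by auto
    then show ?thesis using r_in_A by (auto simp: V_def)
  qed
  have finV: "finite V" using finite_A by (simp add: V_def)
  \<comment> \<open>These two bounds make the truncated subtractions exact.\<close>
  have cardP: "card P > 0" using finite_P R by (auto simp: card_gt_0_iff)
  have cardPA: "card P \<le> card A"
    using card_inj_on_le[OF \<open>inj_on s P\<close> _ finite_A] sP Union_P by blast
  have "card V = card A - (card P - 1)"
    using sub finite_P R inj by (simp add: V_def card_Diff_subset card_image)
  then have cardV: "card V = card A - card P + 1" using cardP cardPA by simp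
  have \<beta>A: "\<beta> permutes A" if "\<beta> permutes V" for \<beta>
    using that by (rule permutes_subset) (auto simp: V_def)
  have exit_off_V: "s (\<kappa> x) \<notin> V \<or> x \<in> R" if "x \<in> A" for x
    using that \<kappa>_block[OF that] \<kappa>[OF R] r by (cases "\<kappa> x = R") (auto simp: V_def)
  have exit_comp: "exits_absorb s (c \<circ> \<beta>) \<longleftrightarrow> exits_absorb s c" if \<beta>: "\<beta> permutes V" for c \<beta>
  proof -
    have "exit_map s (c \<circ> \<beta>) = exit_map s c"
    proof
      fix x
      show "exit_map s (c \<circ> \<beta>) x = exit_map s c x"
        using exit_off_V[of x] selection_eq_r_iff[OF s, of x] permutes_not_in[OF \<beta>, of "s (\<kappa> x)"]
        by (auto simp: exit_map_def override_on_def)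
    qed
    then show ?thesis by (simp add: exits_absorb_def)
  qed
  have count: "card {\<beta>\<in>{\<beta>. \<beta> permutes V}. cyclic_on (c \<circ> \<beta>) A} = fact (card V - 1)"
    if c: "c permutes A" "exits_absorb s c" for c
  proof -
    have "cyclic_on (c \<circ> \<beta>) A \<longleftrightarrow> absorbing (override_on c (c(r := z) \<circ> \<beta>) V) (- A)"
      if \<beta>: "\<beta> permutes V" for \<beta>
      using permutes_not_in[OF \<beta>] rV
      by (intro cyclic_on_comp_iff_absorbing[OF c(1) \<beta>A[OF \<beta>] finite_A r_in_A z])
        (auto simp: override_on_def)
    then have "{\<beta>\<in>{\<beta>. \<beta> permutes V}. cyclic_on (c \<circ> \<beta>) A}
        = {\<beta>. \<beta> permutes V \<and> absorbing (override_on c (c(r := z) \<circ> \<beta>) V) (- A)}" by blast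
    also have "card \<dots> = fact (card V - 1) * card {y\<in>V. reaches c V (- A) ((c(r := z)) y)}"
    proof -
      \<comment> \<open>Outside \<open>V\<close>, a point of \<open>A\<close> is the selected point
        of its own block, which is not \<open>R\<close>, so \<open>exit_map\<close> coincides with
        \<open>c\<close> there. A path of \<open>exit_map\<close>, stopped on entering
        \<open>V\<close>, is therefore a path of \<open>c\<close>.\<close>
      have "reaches c {} (- A \<union> V) x" if "reaches (exit_map s c) {} (- A) x" for x
        using that
      proof induction
        case (step x)
        show ?case
        proof (cases "x \<in> - A \<union> V")
          case False
          then obtain B where B: "B \<in> P" "B \<noteq> R" "x = s B" and x: "x \<in> A" by (auto simp: V_def)
          then have \<kappa>x: "\<kappa> x = B" using \<kappa>[OF B(1)] sP[OF B(1)] by blast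
          then have "x \<notin> R" using \<kappa>[OF R] B(2) by blast
          then have "exit_map s c x = c x"
            using selection_eq_r_iff[OF s x] x B(3) \<kappa>x by (simp add: exit_map_def override_on_def)
          then show ?thesis using step.IH by (auto intro: reaches.step)
        qed (rule reaches.target)
      qed (auto intro: reaches.target)
      then have "reaches c {} (- A \<union> V) x" for x
        using c(2) by (simp add: exits_absorb_def absorbing_def)
      moreover have "V \<inter> - A = {}" by (auto simp: V_def)
      ultimately show ?thesis using finV rV by (subst card_absorbing_permutations) auto
    qed
    also have "{y\<in>V. reaches c V (- A) ((c(r := z)) y)} = {r}"
    proof -
      \<comment> \<open>Since \<open>c\<close> preserves \<open>A\<close>, the only value that leads
        outside is the redirected one at \<open>r\<close>.\<close>
      have "x \<notin> A" if "reaches c V (- A) x" for x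
        using that by induction (auto simp: permutes_in_image[OF c(1)])
      then have "\<not> reaches c V (- A) (c y)" if "y \<in> V" for y
        using that permutes_in_image[OF c(1)] by (auto simp: V_def)
      then show ?thesis using rV z by (auto intro: reaches.target)
    qed
    also have "fact (card V - 1) * card {r} = fact (card V - 1)" by simp
    finally show ?thesis .
  qed
  let ?C = "{c. c permutes A \<and> exits_absorb s c}"
  let ?D = "{c. c permutes A \<and> cyclic_on c A \<and> exits_absorb s c}"
  have finC: "finite ?C" by (rule finite_subset[OF _ finite_permutations[OF finite_A]]) auto
  \<comment> \<open>Double counting of the pairs of \<open>c\<close> and \<open>\<beta>\<close> with
    \<open>c \<circ> \<beta>\<close> cyclic: first by \<open>c\<close>, then by
    \<open>\<beta>\<close>.\<close>
  have "fact (card V - 1) * card ?C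
      = (\<Sum>c\<in>?C. card {\<beta>\<in>{\<beta>. \<beta> permutes V}. cyclic_on (c \<circ> \<beta>) A})"
    using count by simp
  also have "\<dots> = (\<Sum>\<beta>\<in>{\<beta>. \<beta> permutes V}. card {c\<in>?C. cyclic_on (c \<circ> \<beta>) A})"
    by (rule sum_card_filter_swap) (use finC finV in \<open>auto simp: finite_permutations\<close>)
  also have "\<dots> = (\<Sum>\<beta>\<in>{\<beta>. \<beta> permutes V}. card ?D)"
  proof (rule sum.cong[OF refl])
    fix \<beta> assume "\<beta> \<in> {\<beta>. \<beta> permutes V}"
    then have \<beta>: "\<beta> permutes V" by simp
    note inv\<beta> = permutes_inv[OF \<beta>]
    \<comment> \<open>For fixed \<open>\<beta>\<close>, the composition itself serves as the new
      variable, because the exit condition is invariant.\<close>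
    have "bij_betw (\<lambda>c. c \<circ> \<beta>) {c\<in>?C. cyclic_on (c \<circ> \<beta>) A} ?D"
    proof (rule bij_betw_byWitness[where f' = "\<lambda>c. c \<circ> inv \<beta>"])
      show "(\<lambda>c. c \<circ> \<beta>) ` {c\<in>?C. cyclic_on (c \<circ> \<beta>) A} \<subseteq> ?D"
        using exit_comp[OF \<beta>] by (auto intro: permutes_compose[OF \<beta>A[OF \<beta>]])
      show "(\<lambda>c. c \<circ> inv \<beta>) ` ?D \<subseteq> {c\<in>?C. cyclic_on (c \<circ> \<beta>) A}"
        using exit_comp[OF inv\<beta>] permutes_inv_o[OF \<beta>]
        by (auto intro: permutes_compose[OF \<beta>A[OF inv\<beta>]] simp: comp_assoc)
    qed (use permutes_inv_o[OF \<beta>] in \<open>auto simp: comp_assoc\<close>)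
    then show "card {c\<in>?C. cyclic_on (c \<circ> \<beta>) A} = card ?D" by (rule bij_betw_same_card)
  qed
  also have "\<dots> = fact (card V) * card ?D"
    using finV by (simp add: card_permutations)
  also have "\<dots> = fact (card V - 1) * (card V * card ?D)"
    using cardV by (simp add: algebra_simps)
  finally show ?thesis using cardV by simp
qed

text \<open>Summing over selections first, each contributes (N - 1)! |R| after multiplication by N -
  p + 1. The factor |R| completes the number of selections to the product of the block sizes, so the
  choice of root cancels.\<close>

theorem sum_card_cyclic_blockperms:
  "(card A - card P + 1) *
     (\<Sum>c\<in>{c. c permutes A \<and> cyclic_on c A}. card {\<beta>\<in>blockperms P. cyclic_on (c \<circ> \<beta>) A})
   = fact (card A - 1) * (\<Prod>B\<in>P. fact (card B))"
proof -
  let ?C = "{c. c permutes A \<and> cyclic_on c A}"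
  have finC: "finite ?C" by (rule finite_subset[OF _ finite_permutations[OF finite_A]]) auto
  have fin: "finite selections"
    using finite_P block by (auto simp: selections_def intro!: finite_subset[OF _ finite_PiE[of P "\<lambda>B. B"]])
  have "(\<Sum>c\<in>?C. card {\<beta>\<in>blockperms P. cyclic_on (c \<circ> \<beta>) A})
      = (\<Sum>c\<in>?C. (\<Prod>B\<in>P. fact (card B - 1)) * card {s\<in>selections. exits_absorb s c})"
    using card_cyclic_blockperms by (intro sum.cong) auto
  also have "\<dots> = (\<Prod>B\<in>P. fact (card B - 1)) * (\<Sum>s\<in>selections. card {c\<in>?C. exits_absorb s c})"
    unfolding sum_distrib_left[symmetric]
    by (rule arg_cong[where f = "(*) (\<Prod>B\<in>P. fact (card B - 1))"], rule sum_card_filter_swap[OF finC fin])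
  finally have "(card A - card P + 1) * (\<Sum>c\<in>?C. card {\<beta>\<in>blockperms P. cyclic_on (c \<circ> \<beta>) A})
      = (\<Prod>B\<in>P. fact (card B - 1)) *
        (\<Sum>s\<in>selections. (card A - card P + 1) * card {c\<in>?C. exits_absorb s c})"
    by (simp only: sum_distrib_left[symmetric] mult.left_commute)
  also have "\<dots> = (\<Prod>B\<in>P. fact (card B - 1)) * (\<Sum>s\<in>selections. fact (card A - 1) * card R)"
  proof -
    have "(card A - card P + 1) * card {c\<in>?C. exits_absorb s c} = fact (card A - 1) * card R"
      if "s \<in> selections" for s
      using card_cyclic_exits_absorb[OF that] card_exits_absorb[OF that] by (simp add: conj_assoc)
    then show ?thesis by simp
  qed
  also have "\<dots> = fact (card A - 1) * ((\<Prod>B\<in>P. fact (card B - 1)) * (\<Prod>B\<in>P. card B))"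
    using card_selections by (simp add: algebra_simps)
  also have "(\<Prod>B\<in>P. fact (card B - 1)) * (\<Prod>B\<in>P. card B) = (\<Prod>B\<in>P. fact (card B))"
    unfolding prod.distrib[symmetric]
  proof (rule prod.cong[OF refl])
    fix B assume "B \<in> P"
    then have "card B > 0" using block by (auto simp: card_gt_0_iff)
    then show "fact (card B - 1) * card B = fact (card B)" by (cases "card B") auto
  qed
  finally show ?thesis .
qed

end

section \<open>Conjugation, and translation to the given definitions\<close>

lemma cyclic_on_conj_iff:
  assumes g: "g permutes A"
  shows "cyclic_on (g \<circ> \<tau> \<circ> inv g) A \<longleftrightarrow> cyclic_on \<tau> A"
proof
  have gg: "inv g (g x) = x" "g (inv g x) = x" for x
    using permutes_inverses[OF g] by auto
  show "cyclic_on (g \<circ> \<tau> \<circ> inv g) A" if "cyclic_on \<tau> A"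
    using cyclic_on_image[OF that, of "g \<circ> \<tau> \<circ> inv g" g] permutes_image[OF g] gg by simp
  show "cyclic_on \<tau> A" if "cyclic_on (g \<circ> \<tau> \<circ> inv g) A"
    using cyclic_on_image[OF that, of \<tau> "inv g"] permutes_image[OF permutes_inv[OF g]] gg by simp
qed

lemma conj_in_blockperms:
  assumes g: "g permutes \<Union>P" and \<beta>: "\<beta> \<in> blockperms P"
  shows "g \<circ> \<beta> \<circ> inv g \<in> blockperms ((`) g ` P)"
proof -
  have U: "\<Union>((`) g ` P) = \<Union>P" using permutes_image[OF g] by (metis image_Union)
  have "g \<circ> \<beta> \<circ> inv g permutes \<Union>P"
    using \<beta> g by (auto simp: blockperms_def intro!: permutes_compose permutes_inv)
  moreover have "(g \<circ> \<beta> \<circ> inv g) ` (g ` B) \<subseteq> g ` B" if "B \<in> P" for B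
  proof -
    have "\<beta> ` B \<subseteq> B" using that \<beta> by (simp add: blockperms_def)
    then have "g ` (\<beta> ` B) \<subseteq> g ` B" by (rule image_mono)
    then show ?thesis using permutes_inverses[OF g] by (simp add: image_image)
  qed
  ultimately show ?thesis unfolding blockperms_def U by blast
qed

lemma conj_blockperms_bij:
  assumes g: "g permutes \<Union>P"
  shows "bij_betw (\<lambda>\<beta>. g \<circ> \<beta> \<circ> inv g) (blockperms P) (blockperms ((`) g ` P))"
proof (rule bij_betw_byWitness[where f' = "\<lambda>\<beta>. inv g \<circ> \<beta> \<circ> g"])
  have gg: "inv g (g x) = x" "g (inv g x) = x" for x
    using permutes_inverses[OF g] by auto
  have U: "\<Union>((`) g ` P) = \<Union>P" using permutes_image[OF g] by (metis image_Union)
  have P: "(`) (inv g) ` ((`) g ` P) = P"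
    using gg by (simp add: image_image)
  show "(\<lambda>\<beta>. g \<circ> \<beta> \<circ> inv g) ` blockperms P \<subseteq> blockperms ((`) g ` P)"
    using conj_in_blockperms[OF g] by blast
  show "(\<lambda>\<beta>. inv g \<circ> \<beta> \<circ> g) ` blockperms ((`) g ` P) \<subseteq> blockperms P"
    using conj_in_blockperms[of "inv g" "(`) g ` P"] permutes_inv[OF g]
    by (auto simp only: U P permutes_inv_inv[OF g])
qed (use permutes_inverses[OF g] in \<open>auto simp: fun_eq_iff\<close>)

text \<open>On a finite block, invariance under an injective map is equality, so it passes to the
  inverse. This removes the inverse of \<open>\<beta>\<close> from the event being counted.\<close>

lemma inv_blockperms_bij:
  assumes "finite (\<Union>P)"
  shows "bij_betw inv (blockperms P) (blockperms P)"
proof -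
  have sub: "inv ` blockperms P \<subseteq> blockperms P"
  proof
    fix \<gamma> assume "\<gamma> \<in> inv ` blockperms P"
    then obtain \<beta> where \<beta>: "\<gamma> = inv \<beta>" "\<beta> permutes \<Union>P" "\<forall>B\<in>P. \<beta> ` B \<subseteq> B"
      by (auto simp: blockperms_def)
    have "\<gamma> ` B \<subseteq> B" if "B \<in> P" for B
    proof -
      have "finite B" using that assms by (meson Union_upper finite_subset)
      then have "\<beta> ` B = B"
        using \<beta>(3) that permutes_inj_on[OF \<beta>(2)] by (intro endo_inj_surj) auto
      then show ?thesis
        using permutes_inverses[OF \<beta>(2)] \<beta>(1) by (metis image_subset_iff imageE order_refl)
    qed
    then show "\<gamma> \<in> blockperms P" using \<beta> permutes_inv by (auto simp: blockperms_def)
  qed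
  have "\<forall>\<beta>\<in>blockperms P. inv (inv \<beta>) = \<beta>"
    by (auto simp: blockperms_def permutes_inv_inv)
  then show ?thesis using sub by (intro bij_betw_byWitness[where f' = inv])
qed

text \<open>A point lies in its own orbit, so the block containing the orbit must be the block of
  that point; conversely an invariant block contains the orbits of its points.\<close>

lemma S_part_eq_blockperms:
  assumes "partition_on {1..N} P"
  shows "S_part N P = blockperms P"
proof (intro equalityI subsetI)
  have U: "\<Union>P = {1..N}" using assms by (simp add: partition_on_def)
  fix \<beta>
  {
    assume \<beta>: "\<beta> \<in> S_part N P"
    then have p: "\<beta> permutes {1..N}" by (simp add: S_part_def)
    then have perm: "permutation \<beta>" by (auto simp: permutation_permutes)
    have "\<beta> x \<in> B" if x: "x \<in> B" "B \<in> P" for x B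
    proof -
      have "x \<in> {1..N}" using x U by blast
      moreover have "\<forall>x\<in>{1..N}. \<exists>B\<in>P. orbit \<beta> x \<subseteq> B" using \<beta> by (simp add: S_part_def)
      ultimately obtain C where C: "C \<in> P" "orbit \<beta> x \<subseteq> C" by blast
      have "x \<in> C" "\<beta> x \<in> C"
        by (rule subsetD[OF C(2)], rule permutation_self_in_orbit[OF perm] orbit.base)+
      then have "C = B" using C(1) x partition_onD2[OF assms] by (auto simp: disjoint_def)
      then show ?thesis using \<open>\<beta> x \<in> C\<close> by simp
    qed
    then show "\<beta> \<in> blockperms P" using p by (auto simp: blockperms_def U)
  }
  {
    assume \<beta>: "\<beta> \<in> blockperms P"
    have "\<exists>B\<in>P. orbit \<beta> x \<subseteq> B" if "x \<in> {1..N}" for x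
    proof -
      obtain B where B: "x \<in> B" "B \<in> P" using \<open>x \<in> {1..N}\<close> U by blast
      have "y \<in> B" if "y \<in> orbit \<beta> x" for y
        using that by induction (use B \<beta> in \<open>auto simp: blockperms_def\<close>)
      then show ?thesis using B by blast
    qed
    then show "\<beta> \<in> S_part N P" using \<beta> by (auto simp: S_part_def blockperms_def U)
  }
qed

lemma card_is_N_cycle_blockperms:
  assumes "\<sigma> permutes {1..N}" "\<Union>P = {1..N}"
  shows "card {\<beta>\<in>blockperms P. is_N_cycle N (\<sigma> \<circ> inv \<beta>)}
    = card {\<beta>\<in>blockperms P. cyclic_on (\<sigma> \<circ> \<beta>) {1..N}}"
proof (rule bij_betw_same_card, rule bij_betw_Collect[OF inv_blockperms_bij])
  fix \<beta> assume "\<beta> \<in> blockperms P"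
  then have "\<beta> permutes {1..N}" using assms(2) by (simp add: blockperms_def)
  then show "cyclic_on (\<sigma> \<circ> inv \<beta>) {1..N} \<longleftrightarrow> is_N_cycle N (\<sigma> \<circ> inv \<beta>)"
    unfolding is_N_cycle_def using assms(1) by (auto intro: permutes_compose permutes_inv)
qed (use assms in simp)

text \<open>The conjugating map lists the cycle of \<open>\<sigma>\<close> starting from 1.\<close>

lemma long_cycle_conj:
  assumes \<sigma>: "\<sigma> permutes {1..N}" and cyc: "cyclic_on \<sigma> {1..N}" and N: "N \<ge> 1"
  obtains g where "g permutes {1..N}" "\<sigma> \<circ> g = g \<circ> long_cycle N"
proof -
  \<comment> \<open>\<open>n\<close> is the length of the cycle of \<open>\<sigma>\<close> through
    1, which turns out to be \<open>N\<close>.\<close>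
  define n where "n = funpow_dist1 \<sigma> 1 1"
  have orb: "orbit \<sigma> 1 = {1..N}" using cyc N by (auto simp: cyclic_on_alldef)
  then have self: "1 \<in> orbit \<sigma> 1" using N by auto
  have inj: "inj_on (\<lambda>i. (\<sigma> ^^ i) 1) {0..<n}"
    unfolding n_def by (rule inj_on_funpow_dist1[OF self])
  have img: "(\<lambda>i. (\<sigma> ^^ i) 1) ` {0..<n} = {1..N}"
    unfolding n_def using orbit_conv_funpow_dist1[OF self] orb by simp
  have "n = N" using card_image[OF inj] img by simp
  then have period: "(\<sigma> ^^ N) 1 = 1" using funpow_dist1_prop[OF self] by (simp only: n_def)
  \<comment> \<open>The exponent \<open>x - 1\<close> gives \<open>g 1 = 1\<close>; the step from
    \<open>N\<close> back to 1 is the relation \<open>period\<close>.\<close>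
  define g where "g x = (if x \<in> {1..N} then (\<sigma> ^^ (x - 1)) 1 else x)" for x
  have "bij_betw (\<lambda>x. x - 1) {1..N} {0..<N}"
    by (rule bij_betw_byWitness[where f' = Suc]) auto
  moreover have "bij_betw (\<lambda>i. (\<sigma> ^^ i) 1) {0..<N} {1..N}"
    using inj img \<open>n = N\<close> by (simp add: bij_betw_def)
  ultimately have "bij_betw ((\<lambda>i. (\<sigma> ^^ i) 1) \<circ> (\<lambda>x. x - 1)) {1..N} {1..N}"
    by (rule bij_betw_trans)
  then have "bij_betw g {1..N} {1..N}"
    by (rule bij_betw_cong[THEN iffD1, rotated]) (simp add: g_def)
  then have "g permutes {1..N}" by (rule bij_imp_permutes) (auto simp: g_def)
  moreover have "\<sigma> (g x) = g (long_cycle N x)" for x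
  proof -
    consider "1 \<le> x" "x < N" | "x = N" | "x \<notin> {1..N}" by force
    then show ?thesis
    proof cases
      case 1
      then obtain i where "x = Suc i" by (cases x) auto
      then show ?thesis using 1 by (simp add: g_def long_cycle_def)
    next
      case 2
      obtain i where "N = Suc i" using N by (cases N) auto
      then have "\<sigma> (g x) = 1" using 2 period by (simp add: g_def)
      then show ?thesis using 2 N by (simp add: g_def long_cycle_def)
    next
      case 3
      then have "long_cycle N x = x" using N by (auto simp: long_cycle_def)
      moreover have "g x = x" unfolding g_def using 3 by (rule if_not_P)
      ultimately show ?thesis using permutes_not_in[OF \<sigma> 3] by simp
    qed
  qed
  then have "\<sigma> \<circ> g = g \<circ> long_cycle N" by (simp add: fun_eq_iff)
  ultimately show thesis by (rule that)
qed

lemma image_in_set_partitions: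
  assumes g: "g permutes {1..N}" and P: "P \<in> set_partitions_of_type N lam"
  shows "(`) g ` P \<in> set_partitions_of_type N lam"
proof -
  have part: "partition_on {1..N} P" and type: "image_mset card (mset_set P) = lam"
    using P by (auto simp: set_partitions_of_type_def)
  have inj: "inj g" using permutes_inj[OF g] .
  have "\<Union>((`) g ` P) = {1..N}"
    using partition_onD1[OF part] permutes_image[OF g] by (metis image_Union)
  moreover have "disjoint ((`) g ` P)"
    using partition_onD2[OF part] inj by (intro disjoint_image) (auto intro: inj_on_subset)
  ultimately have "partition_on {1..N} ((`) g ` P)"
    using partition_onD3[OF part] by (auto simp: partition_on_def)
  moreover have "image_mset card (mset_set ((`) g ` P)) = lam"
  proof -
    have "inj_on ((`) g) P" using inj by (auto simp: inj_on_def inj_image_eq_iff)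
    then have "mset_set ((`) g ` P) = image_mset ((`) g) (mset_set P)"
      by (simp add: image_mset_mset_set)
    then have "image_mset card (mset_set ((`) g ` P)) = image_mset (\<lambda>B. card (g ` B)) (mset_set P)"
      by (simp add: image_mset.compositionality comp_def)
    also have "\<dots> = image_mset card (mset_set P)"
      using inj by (intro image_mset_cong card_image) (rule inj_on_subset, auto)
    finally show ?thesis using type by simp
  qed
  ultimately show ?thesis by (simp add: set_partitions_of_type_def)
qed

text \<open>Cutting off one block per part shows that there is a set partition to choose, so the
  final average does not divide by zero.\<close>

lemma ex_partition_on_type:
  assumes "finite A" "0 \<notin># lam" "card A = sum_mset lam"
  shows "\<exists>P. partition_on A P \<and> image_mset card (mset_set P) = lam"
  using assms
proof (induction lam arbitrary: A)
  case empty
  then show ?case by (intro exI[of _ "{}"]) (auto simp: partition_on_def)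
next
  case (add k lam)
  obtain B where B: "B \<subseteq> A" "card B = k" "finite B"
    using obtain_subset_with_card_n[of k A] add.prems by auto
  have "card (A - B) = sum_mset lam" using add.prems B by (simp add: card_Diff_subset)
  then obtain P where P: "partition_on (A - B) P" "image_mset card (mset_set P) = lam"
    using add.IH[of "A - B"] add.prems by auto
  have "B \<noteq> {}" using B add.prems by auto
  then have BP: "B \<notin> P" using partition_onD1[OF P(1)] by blast
  have "finite P" using finite_elements[OF _ P(1)] add.prems by simp
  moreover have "disjnt B (\<Union>P)"
    using partition_onD1[OF P(1)] by (auto simp: disjnt_def)
  then have "partition_on A (insert B P)"
    using P(1) B(1) \<open>B \<noteq> {}\<close> by (simp add: partition_on_insert)
  ultimately show ?case using P(2) BP B(2) by (intro exI[of _ "insert B P"]) simp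
qed

theorem theorem1p3:
  fixes N p :: nat and lam :: "nat multiset"
  assumes "N \<ge> 1"
    and "0 \<notin># lam" and "sum_mset lam = N" and "size lam = p"
  shows "(1 / real (card (set_partitions_of_type N lam))) *
           (\<Sum>P\<in>set_partitions_of_type N lam.
              real (card {\<beta>\<in>S_part N P. is_N_cycle N (long_cycle N \<circ> inv \<beta>)})
              / real (card (S_part N P)))
         = 1 / real (N - p + 1)"
proof -
  let ?A = "{1..N}"
  define \<P> where "\<P> = set_partitions_of_type N lam"
  define C where "C = {c. c permutes ?A \<and> cyclic_on c ?A}"
  define q where "q c P = card {\<beta>\<in>blockperms P. cyclic_on (c \<circ> \<beta>) ?A}" for c P
  \<comment> \<open>The common size of all S_\<pi> for \<pi> of type \<open>lam\<close>; because it
    is constant, the two-stage random choice is uniform on pairs.\<close>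
  define L where "L = (\<Prod>k\<in>#lam. fact k :: nat)"
  have part: "partition_on ?A P" and type: "image_mset card (mset_set P) = lam" if "P \<in> \<P>" for P
    using that by (auto simp: \<P>_def set_partitions_of_type_def)
  have U: "\<Union>P = ?A" if "P \<in> \<P>" for P using part[OF that] by (simp add: partition_on_def)
  have finP: "finite P" if "P \<in> \<P>" for P using finite_elements[OF _ part[OF that]] by simp
  have cardP: "card P = p" if "P \<in> \<P>" for P
    using arg_cong[OF type[OF that], of size] assms(4) by simp
  have prodP: "(\<Prod>B\<in>P. fact (card B)) = L" if "P \<in> \<P>" for P
    unfolding L_def type[OF that, symmetric]
    by (simp add: prod_unfold_prod_mset image_mset.compositionality comp_def)
  have "finite \<P>"
    using part by (intro finite_subset[OF _ finitely_many_partition_on[of ?A]]) auto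
  moreover have "\<P> \<noteq> {}"
    using ex_partition_on_type[of ?A lam] assms by (auto simp: \<P>_def set_partitions_of_type_def)
  ultimately have \<P>_pos: "card \<P> > 0" by (simp add: card_gt_0_iff)
  have L_pos: "L > 0" unfolding L_def by (induction lam) auto
  have cardC: "card C = fact (N - 1)"
    unfolding C_def using card_cyclic_permutations[of ?A 1 0] assms(1) by simp
  have avg: "(N - p + 1) * (\<Sum>c\<in>C. q c P) = fact (N - 1) * L" if P: "P \<in> \<P>" for P
  proof -
    have "P \<noteq> {}" using U[OF P] assms(1) by auto
    then obtain R where R: "R \<in> P" by blast
    then obtain r where r: "r \<in> R" using partition_onD3[OF part[OF P]] by (metis all_not_in_conv)
    have blk: "(THE B. B \<in> P \<and> x \<in> B) = B" if "B \<in> P" "x \<in> B" for B x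
      using that partition_onD2[OF part[OF P]] by (auto simp: disjoint_def intro!: the_equality)
    \<comment> \<open>Any block and any point in it may serve as root; 0 is a point outside
      \<open>{1..N}\<close>.\<close>
    interpret rooted_blocks ?A P "\<lambda>x. THE B. B \<in> P \<and> x \<in> B" R r 0
      by unfold_locales (use part[OF P] blk R r in auto)
    show ?thesis
      using sum_card_cyclic_blockperms by (simp add: C_def q_def cardP[OF P] prodP[OF P])
  qed
  \<comment> \<open>Relabelling by \<open>g\<close> permutes the set partitions of the given type
    and carries \<open>long_cycle N\<close> to \<open>c\<close>, so the sum is the same for every
    full cycle.\<close>
  have conj: "(\<Sum>P\<in>\<P>. q c P) = (\<Sum>P\<in>\<P>. q (long_cycle N) P)" if "c \<in> C" for c
  proof -
    have c: "c permutes ?A" "cyclic_on c ?A" using that by (auto simp: C_def)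
    obtain g where g: "g permutes ?A" "c \<circ> g = g \<circ> long_cycle N"
      using long_cycle_conj[OF c assms(1)] .
    have gg: "inv g (g x) = x" "g (inv g x) = x" for x
      using permutes_inverses[OF g(1)] by auto
    have "bij_betw ((`) ((`) g)) \<P> \<P>"
      by (rule bij_betw_byWitness[where f' = "(`) ((`) (inv g))"])
        (use image_in_set_partitions[OF g(1)] image_in_set_partitions[OF permutes_inv[OF g(1)]] gg
          in \<open>auto simp: \<P>_def image_image\<close>)
    then have "(\<Sum>P\<in>\<P>. q c P) = (\<Sum>P\<in>\<P>. q c ((`) g ` P))"
      by (rule sum.reindex_bij_betw[symmetric])
    also have "\<dots> = (\<Sum>P\<in>\<P>. q (long_cycle N) P)"
    proof (rule sum.cong[OF refl])
      fix P assume P: "P \<in> \<P>"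
      have "bij_betw (\<lambda>\<beta>. g \<circ> \<beta> \<circ> inv g) {\<beta>\<in>blockperms P. cyclic_on (long_cycle N \<circ> \<beta>) ?A}
          {\<beta>\<in>blockperms ((`) g ` P). cyclic_on (c \<circ> \<beta>) ?A}"
      proof (rule bij_betw_Collect)
        show "bij_betw (\<lambda>\<beta>. g \<circ> \<beta> \<circ> inv g) (blockperms P) (blockperms ((`) g ` P))"
          using g(1) U[OF P] by (intro conj_blockperms_bij) simp
        fix \<beta>
        have "c \<circ> (g \<circ> \<beta> \<circ> inv g) = g \<circ> (long_cycle N \<circ> \<beta>) \<circ> inv g"
          using g(2) by (metis comp_assoc)
        then show "cyclic_on (c \<circ> (g \<circ> \<beta> \<circ> inv g)) ?A \<longleftrightarrow> cyclic_on (long_cycle N \<circ> \<beta>) ?A"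
          using cyclic_on_conj_iff[OF g(1), of "long_cycle N \<circ> \<beta>"] by (simp only:)
      qed
      then show "q c ((`) g ` P) = q (long_cycle N) P"
        unfolding q_def by (rule bij_betw_same_card[symmetric])
    qed
    finally show ?thesis .
  qed
  \<comment> \<open>Read off from conjugacy with some full cycle, which exists because
    \<open>card C\<close> is nonzero.\<close>
  have long: "long_cycle N permutes ?A"
  proof -
    have "C \<noteq> {}" using cardC by (metis card.empty fact_nonzero)
    then obtain c where c: "c permutes ?A" "cyclic_on c ?A" by (auto simp: C_def)
    obtain g where g: "g permutes ?A" "c \<circ> g = g \<circ> long_cycle N"
      using long_cycle_conj[OF c assms(1)] .
    then have "long_cycle N = inv g \<circ> (c \<circ> g)"
      using permutes_inv_o[OF g(1)] by (simp add: comp_assoc[symmetric])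
    then show ?thesis using g(1) c(1) by (simp add: permutes_compose permutes_inv)
  qed
  \<comment> \<open>The double sum over full cycles and set partitions is evaluated in both orders,
    by \<open>conj\<close> and by \<open>avg\<close>; the factor (N - 1)! then cancels.\<close>
  have "fact (N - 1) * ((N - p + 1) * (\<Sum>P\<in>\<P>. q (long_cycle N) P))
      = (N - p + 1) * (\<Sum>c\<in>C. \<Sum>P\<in>\<P>. q c P)"
    using conj cardC by (simp add: algebra_simps)
  also have "\<dots> = (\<Sum>P\<in>\<P>. (N - p + 1) * (\<Sum>c\<in>C. q c P))"
    unfolding sum_distrib_left[symmetric] by (rule arg_cong[where f = "(*) (N - p + 1)"], rule sum.swap)
  also have "\<dots> = fact (N - 1) * (card \<P> * L)"
    using avg by simp
  finally have "(N - p + 1) * (\<Sum>P\<in>\<P>. q (long_cycle N) P) = card \<P> * L"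
    by simp
  then have count: "real (N - p + 1) * (\<Sum>P\<in>\<P>. real (q (long_cycle N) P)) = real (card \<P>) * real L"
    by (metis of_nat_mult of_nat_sum)
  have "(\<Sum>P\<in>\<P>. real (card {\<beta>\<in>S_part N P. is_N_cycle N (long_cycle N \<circ> inv \<beta>)})
      / real (card (S_part N P))) = (\<Sum>P\<in>\<P>. real (q (long_cycle N) P) / real L)"
  proof (rule sum.cong[OF refl])
    fix P assume P: "P \<in> \<P>"
    have "card (blockperms P) = L"
      using card_blockperms[OF finP[OF P] _ partition_onD2[OF part[OF P]]] prodP[OF P] U[OF P]
      by (metis Union_upper finite_atLeastAtMost finite_subset)
    then show "real (card {\<beta>\<in>S_part N P. is_N_cycle N (long_cycle N \<circ> inv \<beta>)})
        / real (card (S_part N P)) = real (q (long_cycle N) P) / real L"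
      unfolding S_part_eq_blockperms[OF part[OF P]] q_def
      using card_is_N_cycle_blockperms[OF long U[OF P]] by simp
  qed
  also have "\<dots> = (\<Sum>P\<in>\<P>. real (q (long_cycle N) P)) / real L"
    by (rule sum_divide_distrib[symmetric])
  finally show ?thesis
    unfolding \<P>_def[symmetric] using count \<P>_pos L_pos by (simp only:) (simp add: field_simps)
qed

end
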